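(* For every $p$ with $1<p<\infty$ there are continuum many closed ideals in $\mathcal{L}(\ell_p,c_0)$.
   Context: Banach spaces are over the real scalars; an operator is a bounded linear map. $\mathcal{L}(X,Y)$ is the space of all operators from $X$ to $Y$ with the operator norm, and $\mathcal{L}(X)=\mathcal{L}(X,X)$. An (operator) ideal of $\mathcal{L}(X,Y)$ is a linear subspace $\mathcal{J}$ of $\mathcal{L}(X,Y)$ such that $ATB\in\mathcal{J}$ whenever $A\in\mathcal{L}(Y)$, $T\in\mathcal{J}$, $B\in\mathcal{L}(X)$. A closed ideal is an ideal that is closed in the operator norm. "There are continuum many closed ideals" means that there is a family of pairwise distinct closed ideals of cardinality $2^{\aleph_0}$. *)

theory Defs
  imports "HOL-Analysis.Analysis" "HOL-Library.Equipollence"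
begin

text \<open>
  The exponent of \<open>\<ell>\<^sub>p\<close> is a real number, so the spaces are given by carrier sets of real
  sequences together with a norm (meaningful on the carrier only) instead of by types.
\<close>

type_synonym real_seq = "nat \<Rightarrow> real"

record seq_space =
  vecs :: "real_seq set"
  nrm :: "real_seq \<Rightarrow> real"

definition lp :: "real \<Rightarrow> seq_space" where
  "lp p = \<lparr>vecs = {x. summable (\<lambda>n. \<bar>x n\<bar> powr p)},
           nrm = (\<lambda>x. (\<Sum>n. \<bar>x n\<bar> powr p) powr (1 / p))\<rparr>"

definition c0 :: seq_space where
  "c0 = \<lparr>vecs = {x. x \<longlonglongrightarrow> 0}, nrm = (\<lambda>x. SUP n. \<bar>x n\<bar>)\<rparr>"

text \<open>
  Operators are set to the zero sequence outside the carrier of the domain, so that equality of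
  operators is equality of functions, and sums, scalar multiples and composites of operators are
  the plain pointwise ones.
\<close>

definition operators :: "seq_space \<Rightarrow> seq_space \<Rightarrow> (real_seq \<Rightarrow> real_seq) set" where
  "operators X Y = {T.
     (\<forall>x\<in>vecs X. T x \<in> vecs Y) \<and>
     (\<forall>x\<in>vecs X. \<forall>y\<in>vecs X. T (\<lambda>n. x n + y n) = (\<lambda>n. T x n + T y n)) \<and>
     (\<forall>c. \<forall>x\<in>vecs X. T (\<lambda>n. c * x n) = (\<lambda>n. c * T x n)) \<and>
     (\<exists>C. \<forall>x\<in>vecs X. nrm Y (T x) \<le> C * nrm X x) \<and>
     (\<forall>x. x \<notin> vecs X \<longrightarrow> T x = (\<lambda>n. 0))}"

definition op_norm :: "seq_space \<Rightarrow> seq_space \<Rightarrow> (real_seq \<Rightarrow> real_seq) \<Rightarrow> real" where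
  "op_norm X Y T = (SUP x\<in>{x\<in>vecs X. nrm X x \<le> 1}. nrm Y (T x))"

text \<open>
  The value outside the carrier only serves to meet the requirements of \<^locale>\<open>Metric_space\<close>,
  which asks for nonnegativity and symmetry of the distance at all arguments.
\<close>

definition op_dist :: "seq_space \<Rightarrow> seq_space \<Rightarrow> (real_seq \<Rightarrow> real_seq) \<Rightarrow> (real_seq \<Rightarrow> real_seq) \<Rightarrow> real" where
  "op_dist X Y S T =
     (if S \<in> operators X Y \<and> T \<in> operators X Y then op_norm X Y (\<lambda>x n. S x n - T x n) else 0)"

definition op_ideal :: "seq_space \<Rightarrow> seq_space \<Rightarrow> (real_seq \<Rightarrow> real_seq) set \<Rightarrow> bool" where
  "op_ideal X Y J \<longleftrightarrow>
     J \<subseteq> operators X Y \<and>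
     (\<lambda>x n. 0) \<in> J \<and>
     (\<forall>S\<in>J. \<forall>T\<in>J. (\<lambda>x n. S x n + T x n) \<in> J) \<and>
     (\<forall>c. \<forall>T\<in>J. (\<lambda>x n. c * T x n) \<in> J) \<and>
     (\<forall>A\<in>operators Y Y. \<forall>T\<in>J. \<forall>B\<in>operators X X. A \<circ> T \<circ> B \<in> J)"

definition closed_op_ideal :: "seq_space \<Rightarrow> seq_space \<Rightarrow> (real_seq \<Rightarrow> real_seq) set \<Rightarrow> bool" where
  "closed_op_ideal X Y J \<longleftrightarrow>
     op_ideal X Y J \<and>
     closedin (Metric_space.mtopology (operators X Y) (op_dist X Y)) J"

text \<open>
  The topology in the previous definition is the intended one only if the distance is a metric
  on the operators; the following lemmas establish this for operators from \<open>\<ell>\<^sub>p\<close> to \<open>c\<^sub>0\<close>.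
\<close>

lemma vecs_lp [simp]: "x \<in> vecs (lp p) \<longleftrightarrow> summable (\<lambda>n. \<bar>x n\<bar> powr p)"
  and nrm_lp: "nrm (lp p) x = (\<Sum>n. \<bar>x n\<bar> powr p) powr (1 / p)"
  and vecs_c0 [simp]: "x \<in> vecs c0 \<longleftrightarrow> x \<longlonglongrightarrow> 0"
  and nrm_c0: "nrm c0 x = (SUP n. \<bar>x n\<bar>)"
  by (simp_all add: lp_def c0_def)

lemma bdd_above_c0:
  assumes "x \<in> vecs c0"
  shows "bdd_above (range (\<lambda>n. \<bar>x n\<bar>))"
proof -
  have "Bseq x"
    using assms convergent_imp_Bseq by (auto simp: convergent_def)
  then show ?thesis
    by (auto simp: Bseq_def bdd_above_def)
qed

lemma abs_le_nrm_c0: "x \<in> vecs c0 \<Longrightarrow> \<bar>x n\<bar> \<le> nrm c0 x"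
  unfolding nrm_c0 by (rule cSUP_upper[OF _ bdd_above_c0]) auto

lemma nrm_c0_le: "(\<And>n. \<bar>x n\<bar> \<le> C) \<Longrightarrow> nrm c0 x \<le> C"
  unfolding nrm_c0 by (rule cSUP_least) auto

lemma nrm_lp_scale:
  assumes "0 < p" "x \<in> vecs (lp p)"
  shows "nrm (lp p) (\<lambda>n. c * x n) = \<bar>c\<bar> * nrm (lp p) x"
proof -
  have "(\<Sum>n. \<bar>c * x n\<bar> powr p) = \<bar>c\<bar> powr p * (\<Sum>n. \<bar>x n\<bar> powr p)"
    using assms by (simp add: abs_mult powr_mult suminf_mult)
  moreover have "(\<Sum>n. \<bar>x n\<bar> powr p) \<ge> 0"
    using assms by (intro suminf_nonneg) auto
  ultimately show ?thesis
    using assms by (simp add: nrm_lp powr_mult powr_powr)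
qed

lemma operatorsD:
  assumes "T \<in> operators X Y"
  shows "\<And>x. x \<in> vecs X \<Longrightarrow> T x \<in> vecs Y"
    and "\<And>x y. x \<in> vecs X \<Longrightarrow> y \<in> vecs X \<Longrightarrow> T (\<lambda>n. x n + y n) = (\<lambda>n. T x n + T y n)"
    and "\<And>c x. x \<in> vecs X \<Longrightarrow> T (\<lambda>n. c * x n) = (\<lambda>n. c * T x n)"
    and "\<exists>C. \<forall>x\<in>vecs X. nrm Y (T x) \<le> C * nrm X x"
    and "\<And>x. x \<notin> vecs X \<Longrightarrow> T x = (\<lambda>n. 0)"
  using assms unfolding operators_def by blast+

lemma op_diff_mem:
  assumes "S \<in> operators (lp p) c0" "T \<in> operators (lp p) c0"
  shows "(\<lambda>x n. S x n - T x n) \<in> operators (lp p) c0"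
proof -
  obtain C D where C: "\<And>x. x \<in> vecs (lp p) \<Longrightarrow> nrm c0 (S x) \<le> C * nrm (lp p) x"
    and D: "\<And>x. x \<in> vecs (lp p) \<Longrightarrow> nrm c0 (T x) \<le> D * nrm (lp p) x"
    using operatorsD(4)[OF assms(1)] operatorsD(4)[OF assms(2)] by blast
  have ST: "S x \<in> vecs c0" "T x \<in> vecs c0" if "x \<in> vecs (lp p)" for x
    using assms that by (blast dest: operatorsD(1))+
  have "nrm c0 (\<lambda>n. S x n - T x n) \<le> (C + D) * nrm (lp p) x" if x: "x \<in> vecs (lp p)" for x
  proof (rule nrm_c0_le)
    fix n
    show "\<bar>S x n - T x n\<bar> \<le> (C + D) * nrm (lp p) x"
      using C[OF x] D[OF x] abs_le_nrm_c0[OF ST(1)[OF x], of n] abs_le_nrm_c0[OF ST(2)[OF x], of n]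
      by (simp add: algebra_simps)
  qed
  then have "\<exists>C. \<forall>x\<in>vecs (lp p). nrm c0 (\<lambda>n. S x n - T x n) \<le> C * nrm (lp p) x"
    by blast
  moreover have "(\<lambda>n. S x n - T x n) \<in> vecs c0" if "x \<in> vecs (lp p)" for x
    using ST[OF that] tendsto_diff[of "S x" 0 sequentially "T x" 0] by simp
  ultimately show ?thesis
    using assms unfolding operators_def by (auto simp: algebra_simps)
qed

lemma nrm_le_op_norm:
  assumes "T \<in> operators (lp p) c0" "x \<in> vecs (lp p)" "nrm (lp p) x \<le> 1"
  shows "nrm c0 (T x) \<le> op_norm (lp p) c0 T"
  unfolding op_norm_def
proof (rule cSUP_upper)
  obtain C where C: "\<And>x. x \<in> vecs (lp p) \<Longrightarrow> nrm c0 (T x) \<le> C * nrm (lp p) x"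
    using assms unfolding operators_def by blast
  have "nrm c0 (T x) \<le> \<bar>C\<bar>" if "x \<in> vecs (lp p)" "nrm (lp p) x \<le> 1" for x
  proof -
    have "C * nrm (lp p) x \<le> \<bar>C\<bar> * 1"
      using that by (intro mult_mono) (auto simp: nrm_lp)
    then show ?thesis using C[OF that(1)] by simp
  qed
  then show "bdd_above ((\<lambda>x. nrm c0 (T x)) ` {x \<in> vecs (lp p). nrm (lp p) x \<le> 1})"
    by (auto simp: bdd_above_def)
qed (use assms in auto)

lemma zero_in_unit_ball: "(\<lambda>n. 0) \<in> {x \<in> vecs (lp p). nrm (lp p) x \<le> 1}"
  by (auto simp: nrm_lp)

lemma op_norm_le:
  assumes "\<And>x. x \<in> vecs (lp p) \<Longrightarrow> nrm (lp p) x \<le> 1 \<Longrightarrow> nrm c0 (T x) \<le> C"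
  shows "op_norm (lp p) c0 T \<le> C"
  unfolding op_norm_def by (rule cSUP_least) (use assms zero_in_unit_ball[of p] in blast)+

lemma op_norm_nonneg:
  assumes "T \<in> operators (lp p) c0"
  shows "0 \<le> op_norm (lp p) c0 T"
proof -
  have "T (\<lambda>n. 0) \<in> vecs c0"
    using assms zero_in_unit_ball[of p] unfolding operators_def by blast
  then have "0 \<le> nrm c0 (T (\<lambda>n. 0))"
    using abs_le_nrm_c0[of "T (\<lambda>n. 0)" 0] by simp
  also have "\<dots> \<le> op_norm (lp p) c0 T"
    using assms zero_in_unit_ball[of p] by (intro nrm_le_op_norm) auto
  finally show ?thesis .
qed

lemma op_norm_eq_0_imp:
  assumes p: "0 < p" and T: "T \<in> operators (lp p) c0" and 0: "op_norm (lp p) c0 T = 0"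
  shows "T x n = 0"
proof (cases "x \<in> vecs (lp p)")
  case True
  define c where "c = 1 / (1 + nrm (lp p) x)"
  have nn: "nrm (lp p) x \<ge> 0" by (simp add: nrm_lp)
  then have c: "c > 0" by (simp add: c_def)
  have cx: "(\<lambda>n. c * x n) \<in> vecs (lp p)"
    using True by (auto simp: abs_mult powr_mult intro: summable_mult)
  have "nrm (lp p) (\<lambda>n. c * x n) \<le> 1"
    using nn by (subst nrm_lp_scale[OF p True]) (simp add: c_def)
  from nrm_le_op_norm[OF T cx this] have "nrm c0 (T (\<lambda>n. c * x n)) \<le> 0"
    using 0 by simp
  moreover have "T (\<lambda>n. c * x n) \<in> vecs c0"
    using T cx unfolding operators_def by blast
  ultimately have "T (\<lambda>n. c * x n) n = 0"
    using abs_le_nrm_c0[of "T (\<lambda>n. c * x n)" n] by simp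
  moreover have "T (\<lambda>n. c * x n) = (\<lambda>n. c * T x n)"
    using T True unfolding operators_def by blast
  ultimately show ?thesis using c by simp
next
  case False
  then show ?thesis using T unfolding operators_def by auto
qed

lemma Metric_space_operators:
  assumes p: "0 < p"
  shows "Metric_space (operators (lp p) c0) (op_dist (lp p) c0)"
proof
  fix S T
  show "0 \<le> op_dist (lp p) c0 S T"
    by (simp add: op_dist_def op_norm_nonneg op_diff_mem)
  show "op_dist (lp p) c0 S T = op_dist (lp p) c0 T S"
    by (simp add: op_dist_def op_norm_def nrm_c0 abs_minus_commute)
next
  fix S T
  assume S: "S \<in> operators (lp p) c0" and T: "T \<in> operators (lp p) c0"
  show "op_dist (lp p) c0 S T = 0 \<longleftrightarrow> S = T"
  proof
    assume "op_dist (lp p) c0 S T = 0"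
    then have "S x n - T x n = 0" for x n
      using op_norm_eq_0_imp[OF p op_diff_mem[OF S T]] S T by (simp add: op_dist_def)
    then show "S = T" by (simp add: fun_eq_iff)
  next
    assume "S = T"
    have "op_norm (lp p) c0 (\<lambda>x n. 0) \<le> 0"
      by (rule op_norm_le) (rule nrm_c0_le, simp)
    moreover have "0 \<le> op_norm (lp p) c0 (\<lambda>x n. 0)"
      using op_norm_nonneg[OF op_diff_mem[OF S S]] by simp
    ultimately show "op_dist (lp p) c0 S T = 0"
      using \<open>S = T\<close> T by (simp add: op_dist_def)
  qed
next
  fix S T U
  assume S: "S \<in> operators (lp p) c0" and T: "T \<in> operators (lp p) c0"
    and U: "U \<in> operators (lp p) c0"
  have "op_norm (lp p) c0 (\<lambda>x n. S x n - U x n) \<le>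
    op_norm (lp p) c0 (\<lambda>x n. S x n - T x n) + op_norm (lp p) c0 (\<lambda>x n. T x n - U x n)"
  proof (rule op_norm_le, rule nrm_c0_le)
    fix x n
    assume x: "x \<in> vecs (lp p)" "nrm (lp p) x \<le> 1"
    have *: "\<bar>A x n\<bar> \<le> op_norm (lp p) c0 A" if A: "A \<in> operators (lp p) c0" for A
    proof -
      have "A x \<in> vecs c0" using A x unfolding operators_def by blast
      then show ?thesis using abs_le_nrm_c0[of "A x" n] nrm_le_op_norm[OF A x] by simp
    qed
    show "\<bar>S x n - U x n\<bar> \<le> op_norm (lp p) c0 (\<lambda>x n. S x n - T x n) +
      op_norm (lp p) c0 (\<lambda>x n. T x n - U x n)"
      using *[OF op_diff_mem[OF S T]] *[OF op_diff_mem[OF T U]] by simp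
  qed
  then show "op_dist (lp p) c0 S U \<le> op_dist (lp p) c0 S T + op_dist (lp p) c0 T U"
    using S T U by (simp add: op_dist_def)
qed

end

theory Submission
  imports Defs
begin

text \<open>
  Code finite "lines" of points of \<open>\<nat>\<close> on levels \<open>n = 0, 1, \<dots>\<close>: two lines share at most one point,
  and all lines of level \<open>n\<close> have the same length \<open>L\<^sub>n\<close>, which grows very fast. For a set \<open>M\<close> of levels let
  \<open>T\<^sub>M x = (\<phi>\<^sub>c x)\<^sub>c\<close>, where \<open>c\<close> runs over the lines with level in \<open>M\<close> and \<open>\<phi>\<^sub>c\<close> is the indicator of
  the line, normalised in the dual of \<open>\<ell>\<^sub>p\<close>. The operators \<open>S\<close> such that, for every contraction \<open>B\<close> of
  \<open>\<ell>\<^sub>p\<close>, the mean of \<open>\<parallel>S (B u\<^sub>c)\<parallel>\<close> over sufficiently many lines \<open>c\<close> of level \<open>n\<close> (with \<open>u\<^sub>c\<close> the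
  normalised indicator in \<open>\<ell>\<^sub>p\<close>) tends to 0 as \<open>n \<rightarrow> \<infinity>\<close> outside \<open>M\<close> form a closed ideal. Since
  \<open>\<phi>\<^sub>c u\<^sub>c = 1\<close>, it does not contain \<open>T\<^bsub>M'\<^esub>\<close> if \<open>M' - M\<close> is infinite.

  It contains \<open>T\<^sub>M\<close>: for \<open>n \<notin> M\<close>, consider the matrices with rows \<open>\<phi>\<^sub>d \<circ> B\<close> (for \<open>d\<close> of higher level) and
  with rows the coordinates of \<open>B\<close> (which control the \<open>\<phi>\<^sub>d \<circ> B\<close> for \<open>d\<close> of lower level). Each row and
  each column has a number of entries of size at least \<open>1 / L\<^sub>n\<close> that is bounded in terms of \<open>L\<^sub>n\<close>; for
  the columns of the first matrix this holds because lines of higher level are nearly disjoint. Thus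
  few pairs of points have large entries in a common row, each such pair lies on at most one line,
  and on all other lines the row sums are at most 2, which is small compared to \<open>L\<^sub>n powr (1 / p)\<close>.
\<close>

section \<open>Hoelder's inequality and counting\<close>

text \<open>Hoelder's inequality against the constant 1, with \<open>N\<close> an upper bound of the
  cardinality. Young's inequality yields the tangent of \<open>t powr p\<close> at
  \<open>m = T / N\<close> as a lower bound; summing it over \<open>A\<close> gives the
  claim.\<close>

lemma sum_le_power_mean:
  fixes y :: "'a \<Rightarrow> real" and p N :: real
  assumes p: "1 < p" and fin: "finite A" and N: "real (card A) \<le> N" and y: "\<And>s. s \<in> A \<Longrightarrow> 0 \<le> y s"
  shows "(\<Sum>s\<in>A. y s) \<le> N powr (1 - 1 / p) * (\<Sum>s\<in>A. y s powr p) powr (1 / p)"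
proof (cases "(\<Sum>s\<in>A. y s) = 0")
  case False
  define T where "T = (\<Sum>s\<in>A. y s)"
  have T: "T > 0"
    using False sum_nonneg[of A y] y by (simp add: T_def order_less_le)
  have "A \<noteq> {}" using False by auto
  then have cA: "0 < real (card A)"
    using fin by (simp add: card_gt_0_iff)
  have N0: "N > 0" using cA N by linarith
  define m where "m = T / N"
  have m: "m > 0" using T N0 by (simp add: m_def)
  have q: "1 < p / (p - 1)" "1 / p + 1 / (p / (p - 1)) = 1"
    using p by (auto simp: field_simps)
  have young: "p * m powr (p - 1) * y s - (p - 1) * m powr p \<le> y s powr p" if "s \<in> A" for s
  proof -
    have "y s * m powr (p - 1) \<le> y s powr p / p + (m powr (p - 1)) powr (p / (p - 1)) / (p / (p - 1))"
      by (rule Youngs_inequality) (use p q y that in auto)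
    also have "(m powr (p - 1)) powr (p / (p - 1)) = m powr p"
      using p by (simp add: powr_powr)
    finally show ?thesis
      using p by (simp add: field_simps)
  qed
  have "N * m powr p = p * m powr (p - 1) * T - N * ((p - 1) * m powr p)"
  proof -
    have "m powr (p - 1) * T = N * m powr p"
      using m N0 T by (simp add: powr_diff m_def)
    then show ?thesis by (simp add: algebra_simps)
  qed
  also have "\<dots> \<le> p * m powr (p - 1) * T - real (card A) * ((p - 1) * m powr p)"
    using N p by (simp add: mult_right_mono)
  also have "\<dots> = (\<Sum>s\<in>A. p * m powr (p - 1) * y s - (p - 1) * m powr p)"
    by (simp add: sum_subtractf T_def sum_distrib_left)
  also have "\<dots> \<le> (\<Sum>s\<in>A. y s powr p)"
    by (rule sum_mono) (rule young)
  finally have *: "N * m powr p \<le> (\<Sum>s\<in>A. y s powr p)" .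
  have "T = N powr (1 - 1 / p) * (N * m powr p) powr (1 / p)"
  proof -
    have "(N * m powr p) powr (1 / p) = N powr (1 / p) * m"
      using m p N0 by (simp add: powr_mult powr_powr)
    then show ?thesis
      using N0 by (simp add: m_def powr_diff)
  qed
  also have "\<dots> \<le> N powr (1 - 1 / p) * (\<Sum>s\<in>A. y s powr p) powr (1 / p)"
    using * p m N0 by (intro mult_left_mono powr_mono2) auto
  finally show ?thesis by (simp add: T_def)
qed simp

text \<open>Otherwise \<open>G\<close> has a subset with exactly
  \<open>nat \<lfloor>R\<rfloor> + 1\<close> elements, which is at most \<open>R + 1\<close> but
  more than \<open>R\<close>. The point is that a proof of the bound \<open>R\<close> may start from
  the a priori bound \<open>R + 1\<close>.\<close>

lemma finite_card_le_of_finite_subsets: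
  fixes R :: real
  assumes "0 \<le> R"
    and H: "\<And>H. finite H \<Longrightarrow> H \<subseteq> G \<Longrightarrow> real (card H) \<le> R + 1 \<Longrightarrow> real (card H) \<le> R"
  shows "finite G" "real (card G) \<le> R"
proof -
  have False if H': "finite H" "H \<subseteq> G" "card H = nat \<lfloor>R\<rfloor> + 1" for H
  proof -
    have "real (card H) \<le> R + 1" "R < real (card H)"
      using H'(3) \<open>0 \<le> R\<close> by linarith+
    then show False using H[OF H'(1,2)] by simp
  qed
  then have *: "\<not> (\<exists>H. finite H \<and> H \<subseteq> G \<and> card H = nat \<lfloor>R\<rfloor> + 1)" by blast
  show fin: "finite G"
    using * infinite_arbitrarily_large by blast
  show "real (card G) \<le> R"
  proof (rule ccontr)
    assume "\<not> ?thesis"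
    then have "nat \<lfloor>R\<rfloor> + 1 \<le> card G" using \<open>0 \<le> R\<close> by linarith
    then show False
      using * obtain_subset_with_card_n by metis
  qed
qed

text \<open>
  A set with a large row sum contains two points at which that row is large, and such a pair of
  points lies in only one of the sets.
\<close>

lemma card_large_row_sum:
  fixes S :: "'i \<Rightarrow> 'x set" and a :: "'r \<Rightarrow> 'x \<Rightarrow> real" and \<eta> C R :: real
  assumes fin: "finite I" "finite X" and "0 \<le> \<eta>" "0 \<le> R"
    and S: "\<And>i. i \<in> I \<Longrightarrow> S i \<subseteq> X" "\<And>i. i \<in> I \<Longrightarrow> real (card (S i)) * \<eta> \<le> 1"
    and linear: "\<And>i j x y. \<lbrakk>i \<in> I; j \<in> I; x \<noteq> y; x \<in> S i; y \<in> S i; x \<in> S j; y \<in> S j\<rbrakk> \<Longrightarrow> i = j"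
    and col: "\<And>x. x \<in> X \<Longrightarrow> finite {r\<in>K. \<eta> \<le> \<bar>a r x\<bar>} \<and> real (card {r\<in>K. \<eta> \<le> \<bar>a r x\<bar>}) \<le> C"
    and row: "\<And>r. r \<in> K \<Longrightarrow> real (card {x\<in>X. \<eta> \<le> \<bar>a r x\<bar>}) \<le> R"
    and bound: "\<And>r x. r \<in> K \<Longrightarrow> x \<in> X \<Longrightarrow> \<bar>a r x\<bar> \<le> 1"
  shows "real (card {i\<in>I. \<exists>r\<in>K. 2 < \<bar>\<Sum>x\<in>S i. a r x\<bar>}) \<le> real (card X) * (C * R)"
proof -
  define Bad where "Bad = {i\<in>I. \<exists>r\<in>K. 2 < \<bar>\<Sum>x\<in>S i. a r x\<bar>}"
  \<comment> \<open>The partners of \<open>x\<close>: points that are large in some row in which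
    \<open>x\<close> is large. At most \<open>C\<close> rows with at most \<open>R\<close> points
    each contribute.\<close>
  define E where "E x = (\<Union>r\<in>{r\<in>K. \<eta> \<le> \<bar>a r x\<bar>}. {y\<in>X. \<eta> \<le> \<bar>a r y\<bar>})" for x
  have "\<exists>x y. x \<noteq> y \<and> x \<in> S i \<and> y \<in> S i \<and> y \<in> E x" if "i \<in> Bad" for i
  proof -
    from that obtain r where i: "i \<in> I" and r: "r \<in> K" and big: "2 < \<bar>\<Sum>x\<in>S i. a r x\<bar>"
      by (auto simp: Bad_def)
    have SX: "S i \<subseteq> X" and finS: "finite (S i)"
      using S(1)[OF i] fin(2) finite_subset by auto
    show ?thesis
    proof (rule ccontr)
      assume "\<not> ?thesis"
      then have one: "x = y" if "x \<in> S i" "y \<in> S i" "\<eta> \<le> \<bar>a r x\<bar>" "\<eta> \<le> \<bar>a r y\<bar>" for x y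
        using that r SX by (fastforce simp: E_def)
      \<comment> \<open>Without such a pair, row \<open>r\<close> has at most one large entry on
        \<open>S i\<close>. It contributes at most 1, and so do all small entries together.\<close>
      define Z where "Z = {x\<in>S i. \<eta> \<le> \<bar>a r x\<bar>}"
      have Z: "finite Z" "card Z \<le> Suc 0"
        using finS one unfolding card_le_Suc0_iff_eq[OF finite_subset[OF _ finS, of Z]] Z_def
        by (auto simp: card_le_Suc0_iff_eq)
      have "\<bar>\<Sum>x\<in>S i. a r x\<bar> \<le> (\<Sum>x\<in>S i. \<bar>a r x\<bar>)" by (rule sum_abs)
      also have "\<dots> = (\<Sum>x\<in>Z. \<bar>a r x\<bar>) + (\<Sum>x\<in>S i - Z. \<bar>a r x\<bar>)"
        using finS by (metis (no_types, lifting) Z_def mem_Collect_eq subsetI sum.subset_diff add.commute)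
      also have "\<dots> \<le> (\<Sum>x\<in>Z. 1) + (\<Sum>x\<in>S i - Z. \<eta>)"
        using bound[OF r] SX by (intro add_mono sum_mono) (auto simp: Z_def)
      also have "\<dots> \<le> 1 + real (card (S i)) * \<eta>"
        using Z(2) card_mono[OF finS, of "S i - Z"] \<open>0 \<le> \<eta>\<close>
        by (intro add_mono) (auto intro: mult_right_mono)
      finally show False using S(2)[OF i] big by simp
    qed
  qed
  then obtain f g where fg: "\<And>i. i \<in> Bad \<Longrightarrow> f i \<noteq> g i \<and> f i \<in> S i \<and> g i \<in> S i \<and> g i \<in> E (f i)"
    by metis
  have finE: "finite (E x)" for x
    by (rule finite_subset[OF _ fin(2)]) (auto simp: E_def)
  have cardE: "real (card (E x)) \<le> C * R" if x: "x \<in> X" for x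
  proof (cases "{r\<in>K. \<eta> \<le> \<bar>a r x\<bar>} = {}")
    case True
    have "E x = {}" unfolding E_def True by simp
    moreover have "0 \<le> C" using col[OF x] by linarith
    ultimately show ?thesis using \<open>0 \<le> R\<close> by simp
  next
    case False
    have "card (E x) \<le> (\<Sum>r\<in>{r\<in>K. \<eta> \<le> \<bar>a r x\<bar>}. card {y\<in>X. \<eta> \<le> \<bar>a r y\<bar>})"
      unfolding E_def using col[OF x] by (intro card_UN_le) auto
    then have "real (card (E x)) \<le> (\<Sum>r\<in>{r\<in>K. \<eta> \<le> \<bar>a r x\<bar>}. real (card {y\<in>X. \<eta> \<le> \<bar>a r y\<bar>}))"
      by (simp only: of_nat_sum[symmetric] of_nat_le_iff)
    also have "\<dots> \<le> (\<Sum>r\<in>{r\<in>K. \<eta> \<le> \<bar>a r x\<bar>}. R)"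
      by (rule sum_mono) (use row in auto)
    also have "\<dots> \<le> C * R"
      using col[OF x] \<open>0 \<le> R\<close> by (simp add: mult_right_mono)
    finally show ?thesis .
  qed
  \<comment> \<open>By \<open>linear\<close>, a bad index is determined by its pair of points, so it
    remains to count pairs.\<close>
  have "inj_on (\<lambda>i. (f i, g i)) Bad"
  proof (rule inj_onI)
    fix i j
    assume ij: "i \<in> Bad" "j \<in> Bad" and eq: "(f i, g i) = (f j, g j)"
    show "i = j"
      by (rule linear[of i j "f i" "g i"]) (use ij eq fg[OF ij(1)] fg[OF ij(2)] in \<open>auto simp: Bad_def\<close>)
  qed
  moreover have "(\<lambda>i. (f i, g i)) ` Bad \<subseteq> Sigma X E"
    using fg S(1) by (fastforce simp: Bad_def)
  ultimately have "card Bad \<le> card (Sigma X E)"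
    using fin(2) finE by (intro card_inj_on_le) auto
  also have "card (Sigma X E) = (\<Sum>x\<in>X. card (E x))"
    using fin(2) finE by simp
  finally have "real (card Bad) \<le> (\<Sum>x\<in>X. real (card (E x)))"
    by (simp only: of_nat_sum[symmetric] of_nat_le_iff)
  also have "\<dots> \<le> (\<Sum>x\<in>X. C * R)"
    by (rule sum_mono) (rule cardE)
  finally show ?thesis by (simp add: Bad_def)
qed

section \<open>Finitely supported vectors and contractive functionals on \<open>lp p\<close>\<close>

definition fin_vec :: "nat set \<Rightarrow> real_seq \<Rightarrow> real_seq" where
  "fin_vec Z a = (\<lambda>s. if s \<in> Z then a s else 0)"

abbreviation unit_vec :: "nat \<Rightarrow> real_seq" where
  "unit_vec z \<equiv> fin_vec {z} (\<lambda>_. 1)"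

locale lp_exponent =
  fixes p :: real
  assumes p: "1 < p"
begin

lemma nrm_lp_nonneg: "0 \<le> nrm (lp p) x"
  by (simp add: nrm_lp)

lemma sum_powr_le_nrm:
  assumes "x \<in> vecs (lp p)" "finite A"
  shows "(\<Sum>s\<in>A. \<bar>x s\<bar> powr p) powr (1 / p) \<le> nrm (lp p) x"
  unfolding nrm_lp using assms p
  by (intro powr_mono2 sum_le_suminf) (auto intro: sum_nonneg)

lemma sum_powr_le_1:
  assumes "x \<in> vecs (lp p)" "finite A" "nrm (lp p) x \<le> 1"
  shows "(\<Sum>s\<in>A. \<bar>x s\<bar> powr p) \<le> 1"
proof (rule ccontr)
  assume "\<not> ?thesis"
  then have "1 < (\<Sum>s\<in>A. \<bar>x s\<bar> powr p) powr (1 / p)"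
    using p by (intro gr_one_powr) auto
  then show False using sum_powr_le_nrm[OF assms(1,2)] assms(3) by simp
qed

lemma abs_le_nrm_lp:
  assumes "x \<in> vecs (lp p)"
  shows "\<bar>x s\<bar> \<le> nrm (lp p) x"
  using sum_powr_le_nrm[OF assms, of "{s}"] p by (simp add: powr_powr)

lemma fin_vec_sums:
  assumes "finite Z"
  shows "(\<lambda>s. \<bar>fin_vec Z a s\<bar> powr p) sums (\<Sum>s\<in>Z. \<bar>a s\<bar> powr p)"
proof -
  have "(\<lambda>s. \<bar>fin_vec Z a s\<bar> powr p) = (\<lambda>s. if s \<in> Z then \<bar>a s\<bar> powr p else 0)"
    by (auto simp: fin_vec_def)
  then show ?thesis using sums_If_finite_set[OF assms] by simp
qed

lemma fin_vec_mem: "finite Z \<Longrightarrow> fin_vec Z a \<in> vecs (lp p)"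
  using fin_vec_sums[of Z a] by (auto simp: sums_iff)

lemma nrm_fin_vec: "finite Z \<Longrightarrow> nrm (lp p) (fin_vec Z a) = (\<Sum>s\<in>Z. \<bar>a s\<bar> powr p) powr (1 / p)"
  using fin_vec_sums[of Z a] by (simp add: sums_iff nrm_lp)

text \<open>In contrast to \<open>operators\<close>, values outside the carrier are left free here
  and in \<open>lp_contraction\<close>, so that coordinates, sums over a line and the identity
  function qualify as they stand.\<close>

definition contractive_functional :: "(real_seq \<Rightarrow> real) \<Rightarrow> bool" where
  "contractive_functional \<phi> \<longleftrightarrow>
     (\<forall>x\<in>vecs (lp p). \<forall>y\<in>vecs (lp p). \<phi> (\<lambda>n. x n + y n) = \<phi> x + \<phi> y) \<and>
     (\<forall>c. \<forall>x\<in>vecs (lp p). \<phi> (\<lambda>n. c * x n) = c * \<phi> x) \<and>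
     (\<forall>x\<in>vecs (lp p). \<bar>\<phi> x\<bar> \<le> nrm (lp p) x)"

definition lp_contraction :: "(real_seq \<Rightarrow> real_seq) \<Rightarrow> bool" where
  "lp_contraction B \<longleftrightarrow>
     (\<forall>x\<in>vecs (lp p). B x \<in> vecs (lp p) \<and> nrm (lp p) (B x) \<le> nrm (lp p) x) \<and>
     (\<forall>x\<in>vecs (lp p). \<forall>y\<in>vecs (lp p). B (\<lambda>n. x n + y n) = (\<lambda>n. B x n + B y n)) \<and>
     (\<forall>c. \<forall>x\<in>vecs (lp p). B (\<lambda>n. c * x n) = (\<lambda>n. c * B x n))"

lemma contractive_functional_comp:
  assumes "contractive_functional \<phi>" "lp_contraction B"
  shows "contractive_functional (\<lambda>x. \<phi> (B x))"
proof -
  have "\<bar>\<phi> (B x)\<bar> \<le> nrm (lp p) x" if x: "x \<in> vecs (lp p)" for x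
  proof -
    have "B x \<in> vecs (lp p)" "nrm (lp p) (B x) \<le> nrm (lp p) x"
      using assms(2) x unfolding lp_contraction_def by blast+
    moreover from this have "\<bar>\<phi> (B x)\<bar> \<le> nrm (lp p) (B x)"
      using assms(1) unfolding contractive_functional_def by blast
    ultimately show ?thesis by simp
  qed
  then show ?thesis
    using assms unfolding contractive_functional_def lp_contraction_def by simp
qed

lemma contractive_functional_coord: "contractive_functional (\<lambda>x. x s)"
  using abs_le_nrm_lp by (auto simp: contractive_functional_def simp del: vecs_lp)

lemma functional_fin_vec:
  assumes \<phi>: "contractive_functional \<phi>" and "finite Z"
  shows "\<phi> (fin_vec Z a) = (\<Sum>z\<in>Z. a z * \<phi> (unit_vec z))"
  using assms(2)
proof (induction Z rule: finite_induct)
  case empty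
  have "fin_vec {} a \<in> vecs (lp p)" by (rule fin_vec_mem) simp
  then have "\<phi> (\<lambda>n. 0 * fin_vec {} a n) = 0 * \<phi> (fin_vec {} a)"
    using \<phi> unfolding contractive_functional_def by blast
  then show ?case by (simp add: fin_vec_def)
next
  case (insert z Z)
  have mem: "fin_vec Z a \<in> vecs (lp p)" "unit_vec z \<in> vecs (lp p)" "fin_vec {z} a \<in> vecs (lp p)"
    using insert by (simp_all add: fin_vec_mem del: vecs_lp)
  have "fin_vec (insert z Z) a = (\<lambda>n. fin_vec {z} a n + fin_vec Z a n)"
    using insert by (auto simp: fin_vec_def)
  then have "\<phi> (fin_vec (insert z Z) a) = \<phi> (fin_vec {z} a) + \<phi> (fin_vec Z a)"
    using \<phi> mem unfolding contractive_functional_def by metis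
  moreover have "fin_vec {z} a = (\<lambda>n. a z * unit_vec z n)"
    by (auto simp: fin_vec_def)
  then have "\<phi> (fin_vec {z} a) = a z * \<phi> (unit_vec z)"
    using \<phi> mem unfolding contractive_functional_def by metis
  ultimately show ?case using insert by simp
qed

lemma functional_unit_vec_le_1:
  assumes "contractive_functional \<phi>"
  shows "\<bar>\<phi> (unit_vec z)\<bar> \<le> 1"
proof -
  have "\<bar>\<phi> (unit_vec z)\<bar> \<le> nrm (lp p) (unit_vec z)"
    using assms fin_vec_mem[of "{z}"] unfolding contractive_functional_def by blast
  then show ?thesis by (simp add: nrm_fin_vec)
qed

text \<open>Duality: on the vector of signs over \<open>Z\<close> the functional is at least
  \<open>card Z * \<eta>\<close>, while this vector has norm \<open>card Z powr (1 / p)\<close>.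
  This will bound the number of large entries in a row.\<close>

lemma card_large_coeffs:
  assumes \<phi>: "contractive_functional \<phi>" and "0 < \<eta>" and "finite Z"
    and large: "\<And>z. z \<in> Z \<Longrightarrow> \<eta> \<le> \<bar>\<phi> (unit_vec z)\<bar>"
  shows "real (card Z) \<le> (1 / \<eta>) powr (p / (p - 1))"
proof (cases "Z = {}")
  case False
  then have n: "0 < real (card Z)" using \<open>finite Z\<close> by (simp add: card_gt_0_iff)
  define a where "a z = sgn (\<phi> (unit_vec z))" for z
  have a: "\<bar>a z\<bar> powr p = 1" if "z \<in> Z" for z
    using large[OF that] \<open>0 < \<eta>\<close> by (auto simp: a_def sgn_if)
  have "real (card Z) * \<eta> = (\<Sum>z\<in>Z. \<eta>)" by simp
  also have "\<dots> \<le> (\<Sum>z\<in>Z. \<bar>\<phi> (unit_vec z)\<bar>)"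
    by (rule sum_mono) (rule large)
  also have "\<dots> = \<phi> (fin_vec Z a)"
    using functional_fin_vec[OF \<phi> \<open>finite Z\<close>, of a] by (simp add: a_def abs_sgn mult.commute)
  also have "\<dots> \<le> nrm (lp p) (fin_vec Z a)"
    using \<phi> fin_vec_mem[OF \<open>finite Z\<close>, of a] unfolding contractive_functional_def
    by (meson abs_le_D1)
  also have "\<dots> = real (card Z) powr (1 / p)"
    using \<open>finite Z\<close> a by (simp add: nrm_fin_vec)
  finally have "real (card Z) powr (1 - 1 / p) \<le> 1 / \<eta>"
    using n \<open>0 < \<eta>\<close> by (simp add: powr_diff field_simps)
  then have "(real (card Z) powr (1 - 1 / p)) powr (p / (p - 1)) \<le> (1 / \<eta>) powr (p / (p - 1))"
    using p by (intro powr_mono2) auto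
  moreover have "(1 - 1 / p) * (p / (p - 1)) = 1"
    using p by (simp add: field_simps)
  ultimately have "real (card Z) powr 1 \<le> (1 / \<eta>) powr (p / (p - 1))"
    by (simp only: powr_powr)
  then show ?thesis by simp
qed simp

end

section \<open>Lines and their incidences\<close>

definition level :: "nat \<Rightarrow> nat" where
  "level c = fst (prod_decode c)"

definition slope :: "nat \<Rightarrow> nat" where
  "slope c = fst (prod_decode (snd (prod_decode c)))"

definition icept :: "nat \<Rightarrow> nat" where
  "icept c = snd (prod_decode (snd (prod_decode c)))"

text \<open>
  A natural number codes a line \<open>a \<mapsto> slope \<cdot> a + icept\<close> of some level \<open>n\<close>, and also a point
  \<open>(n, a, v)\<close>; the abscissa starts at 1 so that only finitely many lines pass through a point.
\<close>

definition line :: "(nat \<Rightarrow> nat) \<Rightarrow> nat \<Rightarrow> nat set" where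
  "line L c = (\<lambda>a. prod_encode (level c, prod_encode (a, slope c * a + icept c))) ` {1..L (level c)}"

lemma line_code_eqI: "level c = level d \<Longrightarrow> slope c = slope d \<Longrightarrow> icept c = icept d \<Longrightarrow> c = d"
  unfolding level_def slope_def icept_def
  by (metis prod_decode_eq prod_eq_iff)

lemma finite_line [simp]: "finite (line L c)"
  by (simp add: line_def)

lemma card_line [simp]: "card (line L c) = L (level c)"
  unfolding line_def by (subst card_image) (auto simp: inj_on_def)

lemma two_points_determine_line:
  assumes "x \<noteq> y" "x \<in> line L c" "y \<in> line L c" "x \<in> line L d" "y \<in> line L d"
  shows "c = d"
proof -
  from assms obtain a b where "a \<noteq> b"
    and x: "x = prod_encode (level c, prod_encode (a, slope c * a + icept c))"
    and y: "y = prod_encode (level c, prod_encode (b, slope c * b + icept c))"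
    and lev: "level c = level d"
    and A: "slope c * a + icept c = slope d * a + icept d"
    and B: "slope c * b + icept c = slope d * b + icept d"
    by (auto simp: line_def)
  \<comment> \<open>Over the integers the two equations can be subtracted, which leaves the slope
    difference times \<open>a - b\<close>.\<close>
  have "int (slope c) * int a + int (icept c) = int (slope d) * int a + int (icept d)"
    "int (slope c) * int b + int (icept c) = int (slope d) * int b + int (icept d)"
    using A B by (metis of_nat_add of_nat_mult)+
  then have "(int (slope c) - int (slope d)) * (int a - int b) = 0"
    by (simp only: left_diff_distrib right_diff_distrib)
  then have "slope c = slope d" using \<open>a \<noteq> b\<close> by simp
  then show ?thesis using lev A line_code_eqI[of c d] by simp
qed

text \<open>\<open>prod_encode\<close> dominates its arguments, and since the abscissa is at least
  1, slope and intercept are at most the ordinate; so all three parameters of the line are at most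
  \<open>s\<close>. This is what brings the operators into \<open>c0\<close>.\<close>

lemma finite_lines_through: "finite {c. s \<in> line L c}"
proof (rule finite_subset)
  show "{c. s \<in> line L c} \<subseteq>
    (\<lambda>(n, \<alpha>, \<beta>). prod_encode (n, prod_encode (\<alpha>, \<beta>))) ` ({..s} \<times> {..s} \<times> {..s})"
  proof
    fix c assume "c \<in> {c. s \<in> line L c}"
    then obtain a where a: "1 \<le> a"
      and s: "s = prod_encode (level c, prod_encode (a, slope c * a + icept c))"
      by (auto simp: line_def)
    have "level c \<le> s"
      unfolding s by (rule le_prod_encode_1)
    moreover have "slope c * a + icept c \<le> s"
      unfolding s by (rule le_trans[OF le_prod_encode_2 le_prod_encode_2])
    moreover have "slope c \<le> slope c * a" using a by simp
    ultimately have le: "slope c \<le> s" "icept c \<le> s" "level c \<le> s" by linarith+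
    show "c \<in> (\<lambda>(n, \<alpha>, \<beta>). prod_encode (n, prod_encode (\<alpha>, \<beta>))) ` ({..s} \<times> {..s} \<times> {..s})"
    proof (rule image_eqI)
      show "c = (\<lambda>(n, \<alpha>, \<beta>). prod_encode (n, prod_encode (\<alpha>, \<beta>))) (level c, slope c, icept c)"
        by (simp add: level_def slope_def icept_def)
    qed (use le in simp)
  qed
qed (intro finite_imageI finite_cartesian_product finite_atMost)

section \<open>Lengths of the lines\<close>

context lp_exponent
begin

text \<open>The exponent makes \<open>len_gap\<close> true.\<close>

definition growth :: nat where
  "growth = nat \<lceil>(p + 1) * (p / (p - 1))\<rceil> + 2"

primrec len :: "nat \<Rightarrow> nat" where
  "len 0 = 1"
| "len (Suc n) = (2 * len n) ^ growth"

lemma len_ge_1: "1 \<le> len n"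
  by (induction n) auto

lemma len_pos: "0 < real (len n)"
  using len_ge_1[of n] by simp

lemma len_Suc_ge: "4 * (len n * len n) \<le> len (Suc n)"
proof -
  have "4 * (len n * len n) = (2 * len n) ^ 2" by (simp add: power2_eq_square)
  also have "\<dots> \<le> (2 * len n) ^ growth"
    using len_ge_1[of n] by (intro power_increasing) (auto simp: growth_def)
  finally show ?thesis by simp
qed

lemma pow2_le_len: "2 ^ n \<le> len n"
proof (induction n)
  case (Suc n)
  have "2 ^ Suc n \<le> 2 * len n" using Suc by simp
  also have "\<dots> \<le> 4 * (len n * len n)" using len_ge_1[of n] by simp
  finally show ?case using len_Suc_ge[of n] by simp
qed simp

lemma len_mono:
  assumes "m \<le> n"
  shows "len m \<le> len n"
proof (rule lift_Suc_mono_le[of len, OF _ assms])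
  fix k
  have "len k \<le> 4 * (len k * len k)" using len_ge_1[of k] by simp
  then show "len k \<le> len (Suc k)" using len_Suc_ge[of k] by (rule le_trans)
qed

text \<open>Makes lines of lower level so short that a bound on single coordinates suffices for
  them.\<close>

lemma len_mult_pow2_le:
  assumes "m < n"
  shows "len m * 2 ^ n \<le> len n"
proof (cases n)
  case (Suc k)
  have "len m * 2 ^ n \<le> len k * (2 * len k)"
    using assms Suc pow2_le_len[of k] by (intro mult_le_mono len_mono) auto
  then show ?thesis using len_Suc_ge[of k] Suc by simp
qed (use assms in simp)

text \<open>Room for overlaps: about \<open>(2 * len m) powr p\<close> exceptional points on a line
  of level \<open>n\<close> are negligible even after multiplication by
  \<open>2 * len m\<close>.\<close>

lemma len_gap:
  assumes "m < n"
  shows "(2 * real (len m)) powr (p + 1) \<le> real (len n) powr (1 - 1 / p)"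
proof -
  have "(p + 1) * (p / (p - 1)) \<le> real growth"
    unfolding growth_def by linarith
  then have "(p + 1) * (p / (p - 1)) * (1 - 1 / p) \<le> real growth * (1 - 1 / p)"
    using p by (intro mult_right_mono) auto
  moreover have "(p + 1) * (p / (p - 1)) * (1 - 1 / p) = p + 1"
    using p by (simp add: field_simps)
  ultimately have e: "p + 1 \<le> real growth * (1 - 1 / p)" by simp
  have "(2 * real (len m)) powr (p + 1) \<le> (2 * real (len m)) powr (real growth * (1 - 1 / p))"
    using e len_ge_1[of m] by (intro powr_mono) auto
  also have "\<dots> = real (len (Suc m)) powr (1 - 1 / p)"
    using len_ge_1[of m] by (simp add: powr_powr[symmetric] powr_realpow)
  also have "\<dots> \<le> real (len n) powr (1 - 1 / p)"
    using p len_mono[of "Suc m" n] assms by (intro powr_mono2) (auto simp del: len.simps)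
  finally show ?thesis .
qed

section \<open>Functionals and unit vectors of the lines\<close>

definition \<phi> :: "nat \<Rightarrow> real_seq \<Rightarrow> real" where
  "\<phi> c y = real (len (level c)) powr (1 / p - 1) * (\<Sum>s\<in>line len c. y s)"

lemma abs_\<phi>_le: "\<bar>\<phi> c y\<bar> \<le> (\<Sum>s\<in>line len c. \<bar>y s\<bar> powr p) powr (1 / p)"
proof -
  have "\<bar>\<Sum>s\<in>line len c. y s\<bar> \<le> (\<Sum>s\<in>line len c. \<bar>y s\<bar>)" by (rule sum_abs)
  also have "\<dots> \<le> real (len (level c)) powr (1 - 1 / p) * (\<Sum>s\<in>line len c. \<bar>y s\<bar> powr p) powr (1 / p)"
    by (rule sum_le_power_mean) (use p in auto)
  finally have "\<bar>\<phi> c y\<bar> \<le> real (len (level c)) powr (1 / p - 1) *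
      (real (len (level c)) powr (1 - 1 / p) * (\<Sum>s\<in>line len c. \<bar>y s\<bar> powr p) powr (1 / p))"
    by (auto simp: \<phi>_def abs_mult intro!: mult_left_mono)
  also have "\<dots> = (\<Sum>s\<in>line len c. \<bar>y s\<bar> powr p) powr (1 / p)"
    using len_pos[of "level c"] by (simp add: mult.assoc[symmetric] powr_add[symmetric])
  finally show ?thesis .
qed

lemma contractive_functional_\<phi>: "contractive_functional (\<phi> c)"
proof -
  have "\<bar>\<phi> c x\<bar> \<le> nrm (lp p) x" if "x \<in> vecs (lp p)" for x
    using abs_\<phi>_le[of c x] sum_powr_le_nrm[OF that finite_line] by (rule order_trans)
  then show ?thesis
    unfolding contractive_functional_def
    by (simp add: \<phi>_def sum.distrib distrib_left sum_distrib_left mult.left_commute)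
qed

text \<open>All but finitely many lines avoid the first \<open>D\<close> points, and beyond these
  the sum of the powers \<open>\<bar>y s\<bar> powr p\<close> is small; \<open>abs_\<phi>_le\<close>
  transfers this to \<open>\<phi> c y\<close>.\<close>

lemma \<phi>_tendsto_0:
  assumes "y \<in> vecs (lp p)"
  shows "(\<lambda>c. \<phi> c y) \<longlonglongrightarrow> 0"
proof (rule LIMSEQ_I)
  fix \<epsilon> :: real
  assume \<epsilon>: "0 < \<epsilon>"
  have "summable (\<lambda>s. \<bar>y s\<bar> powr p)" using assms by simp
  then obtain D where D: "\<And>m n. m \<ge> D \<Longrightarrow> norm (\<Sum>s\<in>{m..<n}. \<bar>y s\<bar> powr p) < \<epsilon> powr p"
    unfolding summable_Cauchy using \<epsilon> by (metis powr_gt_zero less_irrefl)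
  have "finite (\<Union>s\<in>{..<D}. {c. s \<in> line len c})"
    using finite_lines_through by blast
  then obtain N where N: "\<And>c s. s < D \<Longrightarrow> s \<in> line len c \<Longrightarrow> c < N"
    unfolding finite_nat_set_iff_bounded by blast
  have "\<bar>\<phi> c y\<bar> < \<epsilon>" if c: "c \<ge> N" for c
  proof -
    have sub: "line len c \<subseteq> {D..<Suc (Max (line len c))}"
      using N c by (auto simp: not_less less_Suc_eq_le) (meson linorder_not_less)
    have "(\<Sum>s\<in>line len c. \<bar>y s\<bar> powr p) \<le> (\<Sum>s\<in>{D..<Suc (Max (line len c))}. \<bar>y s\<bar> powr p)"
      by (rule sum_mono2) (use sub in auto)
    also have "\<dots> < \<epsilon> powr p" 
      by (rule le_less_trans[OF abs_ge_self D[OF order_refl, unfolded real_norm_def]])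
    finally have "(\<Sum>s\<in>line len c. \<bar>y s\<bar> powr p) powr (1 / p) < (\<epsilon> powr p) powr (1 / p)"
      using p by (intro powr_less_mono2) (auto intro: sum_nonneg)
    then show ?thesis using abs_\<phi>_le[of c y] p \<epsilon> by (simp add: powr_powr)
  qed
  then show "\<exists>no. \<forall>n\<ge>no. norm (\<phi> n y - 0) < \<epsilon>" by auto
qed

definition flat_vec :: "nat \<Rightarrow> real_seq" where
  "flat_vec c = fin_vec (line len c) (\<lambda>_. real (len (level c)) powr (- (1 / p)))"

lemma flat_vec_mem: "flat_vec c \<in> vecs (lp p)"
  unfolding flat_vec_def by (rule fin_vec_mem) simp

lemma nrm_flat_vec: "nrm (lp p) (flat_vec c) = 1"
proof -
  have "(real (len (level c)) powr (- (1 / p))) powr p = 1 / real (len (level c))"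
    unfolding powr_powr using p len_pos[of "level c"] by (simp add: powr_neg_one)
  then show ?thesis
    using p len_pos[of "level c"] by (simp add: flat_vec_def nrm_fin_vec)
qed

lemma \<phi>_flat_vec: "\<phi> c (flat_vec c) = 1"
proof -
  have "(\<Sum>s\<in>line len c. flat_vec c s) = real (len (level c)) * real (len (level c)) powr (- (1 / p))"
    by (simp add: flat_vec_def fin_vec_def)
  also have "\<dots> = real (len (level c)) powr (1 - 1 / p)"
    using len_pos[of "level c"] by (simp add: powr_diff powr_minus_divide)
  finally show ?thesis
    using len_pos[of "level c"] by (simp add: \<phi>_def powr_add[symmetric])
qed

text \<open>Turns values at \<open>flat_vec c\<close> into row sums of the matrix with entries
  \<open>\<psi> (unit_vec z)\<close>.\<close>

lemma functional_flat_vec: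
  assumes "contractive_functional \<psi>"
  shows "\<psi> (flat_vec c) = real (len (level c)) powr (- (1 / p)) * (\<Sum>z\<in>line len c. \<psi> (unit_vec z))"
  unfolding flat_vec_def functional_fin_vec[OF assms finite_line] by (simp add: sum_distrib_left)

text \<open>
  Finitely many lines of higher levels overlap so little that they may be replaced by disjoint
  sets.
\<close>

lemma card_large_\<phi>:
  fixes n :: nat
  assumes y: "y \<in> vecs (lp p)" "nrm (lp p) y \<le> 1"
  defines "G \<equiv> {c. n < level c \<and> 1 / real (len n) \<le> \<bar>\<phi> c y\<bar>}"
  shows "finite G" "real (card G) \<le> (2 * real (len n)) powr p"
proof -
  define l where "l = real (len n)"
  define K where "K = (2 * l) powr p"
  have l: "0 < l" using len_pos by (simp add: l_def)
  have main: "real (card H) \<le> K" if fin: "finite H" and sub: "H \<subseteq> G" and cH: "real (card H) \<le> K + 1" for H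
  proof -
    define S where "S c = line len c - (\<Union>d\<in>H - {c}. line len d)" for c
    have S: "1 / K \<le> (\<Sum>s\<in>S c. \<bar>y s\<bar> powr p)" if c: "c \<in> H" for c
    proof -
      define N where "N = real (len (level c)) powr (1 - 1 / p)"
      have N: "0 < N" using len_pos[of "level c"] by (simp add: N_def)
      have lev: "n < level c" and large: "1 / l \<le> \<bar>\<phi> c y\<bar>"
        using c sub by (auto simp: G_def l_def)
      \<comment> \<open>This is \<open>len_gap\<close>, since
        \<open>2 * l * K = (2 * l) powr (p + 1)\<close>.\<close>
      have KN: "2 * l * K \<le> N"
        using len_gap[OF lev] l by (simp add: K_def N_def l_def powr_add mult.commute)
      \<comment> \<open>The points removed from line \<open>c\<close>: at most one for each other
        line in \<open>H\<close>, hence at most \<open>K\<close> because \<open>H\<close> has at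
        most \<open>K + 1\<close> elements.\<close>
      define V where "V = line len c - S c"
      have V: "V = (\<Union>d\<in>H - {c}. line len c \<inter> line len d)"
        by (auto simp: V_def S_def)
      have "card (line len c \<inter> line len d) \<le> 1" if "d \<in> H - {c}" for d
        using two_points_determine_line[of _ _ len c d] that
        by (auto simp: card_le_Suc0_iff_eq)
      then have "card V \<le> (\<Sum>d\<in>H - {c}. 1)"
        unfolding V using fin by (intro order_trans[OF card_UN_le] sum_mono) auto
      also have "\<dots> = card H - 1" using fin c by simp
      finally have "real (card V) \<le> real (card H - 1)" by simp
      also have "\<dots> \<le> K"
        using cH c fin by (cases "card H") (auto simp: K_def)
      finally have cV: "real (card V) \<le> K" .
      have "\<bar>y s\<bar> \<le> 1" for s
        using abs_le_nrm_lp[OF y(1), of s] y(2) by simp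
      then have yV: "(\<Sum>s\<in>V. \<bar>y s\<bar>) \<le> K"
        using sum_bounded_above[of V "\<lambda>s. \<bar>y s\<bar>" 1] cV by simp
      have "\<bar>\<phi> c y\<bar> * N = \<bar>\<Sum>s\<in>line len c. y s\<bar>"
        using len_pos[of "level c"]
        by (simp add: \<phi>_def N_def abs_mult mult.commute mult.left_commute powr_add[symmetric])
      also have "\<dots> \<le> (\<Sum>s\<in>line len c. \<bar>y s\<bar>)" by (rule sum_abs)
      also have "\<dots> = (\<Sum>s\<in>V. \<bar>y s\<bar>) + (\<Sum>s\<in>S c. \<bar>y s\<bar>)"
        unfolding V_def by (rule sum.subset_diff) (auto simp: S_def)
      finally have "N / l \<le> K + (\<Sum>s\<in>S c. \<bar>y s\<bar>)"
        using yV mult_right_mono[OF large, of N] N by simp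
      \<comment> \<open>The removed points account for at most half of the sum, so the other half
        stays on \<open>S c\<close>.\<close>
      moreover have "K \<le> N / l / 2" using KN l by (simp add: field_simps)
      ultimately have "N / (2 * l) \<le> (\<Sum>s\<in>S c. \<bar>y s\<bar>)" by (simp add: field_simps)
      also have "\<dots> \<le> N * (\<Sum>s\<in>S c. \<bar>y s\<bar> powr p) powr (1 / p)"
        unfolding N_def using card_mono[of "line len c" "S c"] p
        by (intro sum_le_power_mean) (auto simp: S_def)
      finally have "1 / (2 * l) \<le> (\<Sum>s\<in>S c. \<bar>y s\<bar> powr p) powr (1 / p)"
        using N l by (simp add: field_simps)
      then have "(1 / (2 * l)) powr p \<le> ((\<Sum>s\<in>S c. \<bar>y s\<bar> powr p) powr (1 / p)) powr p"
        using p l by (intro powr_mono2) auto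
      then show ?thesis
        using p l by (simp add: powr_powr K_def powr_divide sum_nonneg)
    qed
    \<comment> \<open>The \<open>S c\<close> are disjoint, so their shares of the total mass 1 add
      up.\<close>
    have "real (card H) * (1 / K) = (\<Sum>c\<in>H. 1 / K)" by simp
    also have "\<dots> \<le> (\<Sum>c\<in>H. \<Sum>s\<in>S c. \<bar>y s\<bar> powr p)"
      by (rule sum_mono) (rule S)
    also have "\<dots> = (\<Sum>s\<in>(\<Union>c\<in>H. S c). \<bar>y s\<bar> powr p)"
      using fin by (intro sum.UNION_disjoint[symmetric]) (auto simp: S_def)
    also have "\<dots> \<le> 1"
      using fin y by (intro sum_powr_le_1) (auto simp: S_def simp del: vecs_lp)
    finally show ?thesis using l by (simp add: K_def field_simps)
  qed
  have K: "0 \<le> K" by (simp add: K_def)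
  show "finite G" "real (card G) \<le> (2 * real (len n)) powr p"
    using finite_card_le_of_finite_subsets[OF K main] unfolding K_def l_def by blast+
qed

end

section \<open>Norm estimates in \<open>c0\<close>\<close>

lemma nrm_c0_nonneg: "x \<in> vecs c0 \<Longrightarrow> 0 \<le> nrm c0 x"
  using abs_le_nrm_c0[of x 0] by simp

lemma nrm_c0_scale_le:
  assumes "x \<in> vecs c0"
  shows "nrm c0 (\<lambda>n. c * x n) \<le> \<bar>c\<bar> * nrm c0 x"
  by (rule nrm_c0_le) (simp add: abs_mult abs_le_nrm_c0[OF assms] mult_left_mono)

section \<open>The finite grid of one level and its exceptional lines\<close>

context lp_exponent
begin

text \<open>
  Level \<open>n\<close> has of the order of \<open>len\<^sup>2 \<cdot> side\<close> points but \<open>side\<^sup>2\<close> lines, so that a large \<open>side\<close> makes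
  the lines through exceptional pairs of points negligible.
\<close>

definition side :: "nat \<Rightarrow> nat" where
  "side n = nat \<lceil>4 * real (len n) ^ 3 * ((2 * real (len n)) powr p * real (len n) powr (p / (p - 1)))\<rceil>"

definition lines :: "nat \<Rightarrow> nat set" where
  "lines n = {c. level c = n \<and> slope c < side n \<and> icept c < side n}"

definition points :: "nat \<Rightarrow> nat set" where
  "points n = (\<lambda>(a, v). prod_encode (n, prod_encode (a, v))) ` ({1..len n} \<times> {..<(len n + 1) * side n})"

lemma side_ge: "4 * real (len n) ^ 3 * ((2 * real (len n)) powr p * real (len n) powr (p / (p - 1))) \<le> real (side n)"
  unfolding side_def by linarith

lemma side_pos: "0 < side n"
proof -
  have "0 < 4 * real (len n) ^ 3 * ((2 * real (len n)) powr p * real (len n) powr (p / (p - 1)))"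
    using len_pos[of n] by simp
  then show ?thesis using side_ge[of n] by linarith
qed

lemma lines_eq: "lines n = (\<lambda>(\<alpha>, \<beta>). prod_encode (n, prod_encode (\<alpha>, \<beta>))) ` ({..<side n} \<times> {..<side n})"
proof
  show "lines n \<subseteq> (\<lambda>(\<alpha>, \<beta>). prod_encode (n, prod_encode (\<alpha>, \<beta>))) ` ({..<side n} \<times> {..<side n})"
  proof
    fix c assume c: "c \<in> lines n"
    show "c \<in> (\<lambda>(\<alpha>, \<beta>). prod_encode (n, prod_encode (\<alpha>, \<beta>))) ` ({..<side n} \<times> {..<side n})"
    proof (rule image_eqI)
      show "c = (\<lambda>(\<alpha>, \<beta>). prod_encode (n, prod_encode (\<alpha>, \<beta>))) (slope c, icept c)"
        using c by (auto simp: lines_def level_def slope_def icept_def)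
    qed (use c in \<open>simp add: lines_def\<close>)
  qed
qed (auto simp: lines_def level_def slope_def icept_def)

lemma finite_lines [simp]: "finite (lines n)"
  by (simp add: lines_eq)

lemma card_lines: "card (lines n) = side n * side n"
  unfolding lines_eq by (subst card_image) (auto simp: inj_on_def)

lemma finite_points [simp]: "finite (points n)"
  by (simp add: points_def)

lemma card_points_le: "card (points n) \<le> len n * ((len n + 1) * side n)"
  unfolding points_def by (rule order_trans[OF card_image_le]) auto

lemma line_subset_points:
  assumes "c \<in> lines n"
  shows "line len c \<subseteq> points n"
proof
  fix s assume "s \<in> line len c"
  then obtain a where a: "a \<in> {1..len n}" and s: "s = prod_encode (n, prod_encode (a, slope c * a + icept c))"
    using assms by (auto simp: line_def lines_def)
  have "slope c * a \<le> side n * len n"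
    using a assms by (intro mult_le_mono) (auto simp: lines_def)
  then have "slope c * a + icept c < (len n + 1) * side n"
    using assms by (simp add: lines_def algebra_simps)
  then show "s \<in> points n"
    using a unfolding s points_def by (intro image_eqI[of _ _ "(a, slope c * a + icept c)"]) auto
qed

text \<open>Common form of the two matrices of the argument, with entries
  \<open>\<psi> r (unit_vec x)\<close>. The columns are controlled by hypothesis, the rows by
  \<open>card_large_coeffs\<close>, so \<open>card_large_row_sum\<close> applies. The factor
  \<open>2 * len n\<close> lets two such exceptional sets together have a share of at most
  \<open>1 / len n\<close>.\<close>

lemma card_large_on_flat_vec:
  fixes n :: nat
  assumes \<psi>: "\<And>r. r \<in> K \<Longrightarrow> contractive_functional (\<psi> r)"
    and col: "\<And>x. finite {r\<in>K. 1 / real (len n) \<le> \<bar>\<psi> r (unit_vec x)\<bar>} \<and>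
      real (card {r\<in>K. 1 / real (len n) \<le> \<bar>\<psi> r (unit_vec x)\<bar>}) \<le> (2 * real (len n)) powr p"
  shows "2 * real (len n) *
    real (card {c\<in>lines n. \<exists>r\<in>K. 2 * real (len n) powr (- (1 / p)) < \<bar>\<psi> r (flat_vec c)\<bar>})
    \<le> real (card (lines n))"
proof -
  define l where "l = real (len n)"
  define W where "W = (2 * l) powr p * l powr (p / (p - 1))"
  have l: "1 \<le> l" using len_ge_1[of n] by (simp add: l_def)
  have W: "0 \<le> W" by (simp add: W_def)
  have lev: "level c = n" if "c \<in> lines n" for c using that by (simp add: lines_def)
  have row: "real (card {x\<in>points n. 1 / l \<le> \<bar>\<psi> r (unit_vec x)\<bar>}) \<le> l powr (p / (p - 1))" if "r \<in> K" for r
  proof -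
    have "real (card {x\<in>points n. 1 / l \<le> \<bar>\<psi> r (unit_vec x)\<bar>}) \<le> (1 / (1 / l)) powr (p / (p - 1))"
      by (rule card_large_coeffs[OF \<psi>[OF that]]) (use l in auto)
    then show ?thesis by simp
  qed
  \<comment> \<open>The normalisation of \<open>flat_vec c\<close> turns the threshold
    \<open>2 * l powr (- (1 / p))\<close> into the row sum 2.\<close>
  have eq: "{c\<in>lines n. \<exists>r\<in>K. 2 * l powr (- (1 / p)) < \<bar>\<psi> r (flat_vec c)\<bar>}
    = {c\<in>lines n. \<exists>r\<in>K. 2 < \<bar>\<Sum>x\<in>line len c. \<psi> r (unit_vec x)\<bar>}"
  proof -
    have "2 * l powr (- (1 / p)) < \<bar>\<psi> r (flat_vec c)\<bar> \<longleftrightarrow> 2 < \<bar>\<Sum>x\<in>line len c. \<psi> r (unit_vec x)\<bar>"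
      if "c \<in> lines n" "r \<in> K" for c r
      unfolding functional_flat_vec[OF \<psi>[OF that(2)]] lev[OF that(1)] l_def[symmetric]
      using l by (simp add: abs_mult)
    then show ?thesis by blast
  qed
  have few: "real (card {c\<in>lines n. \<exists>r\<in>K. 2 < \<bar>\<Sum>x\<in>line len c. \<psi> r (unit_vec x)\<bar>})
    \<le> real (card (points n)) * W"
    unfolding W_def
  proof (rule card_large_row_sum[where \<eta> = "1 / l"])
    show "real (card (line len c)) * (1 / l) \<le> 1" if "c \<in> lines n" for c
      using lev[OF that] l by (simp add: l_def)
    show "c = d" if "x \<noteq> y" "x \<in> line len c" "y \<in> line len c" "x \<in> line len d" "y \<in> line len d" for c d x y
      using two_points_determine_line[OF that] .
  qed (use l col row line_subset_points functional_unit_vec_le_1[OF \<psi>] in \<open>auto simp: l_def\<close>)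
  \<comment> \<open>Here the choice of \<open>side\<close> enters: the left side is at most
    \<open>4 * l ^ 3 * W\<close> times \<open>side n\<close>, and there are
    \<open>side n * side n\<close> lines.\<close>
  have many: "2 * l * (real (card (points n)) * W) \<le> real (card (lines n))"
  proof -
    have "real (card (points n)) \<le> real (len n * ((len n + 1) * side n))"
      using card_points_le[of n] by (rule of_nat_mono)
    also have "\<dots> = l * ((l + 1) * real (side n))"
      by (simp add: l_def algebra_simps)
    also have "\<dots> \<le> l * ((2 * l) * real (side n))"
      using l by (intro mult_left_mono mult_right_mono) auto
    finally have "2 * l * (real (card (points n)) * W) \<le> 2 * l * (l * (2 * l * real (side n)) * W)"
      using l W by (intro mult_left_mono mult_right_mono) auto
    also have "\<dots> = (4 * l ^ 3 * W) * real (side n)"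
      by (simp add: power3_eq_cube)
    also have "\<dots> \<le> real (side n) * real (side n)"
      using side_ge[of n] by (intro mult_right_mono) (auto simp: W_def l_def)
    finally show ?thesis by (simp add: card_lines)
  qed
  show ?thesis
    unfolding l_def[symmetric] eq by (rule order_trans[OF mult_left_mono[OF few] many]) (use l in simp)
qed

text \<open>Chebyshev's inequality; it bounds the columns of the matrix formed by the coordinates of
  \<open>B\<close>.\<close>

lemma card_large_coords:
  assumes y: "y \<in> vecs (lp p)" "nrm (lp p) y \<le> 1" and l: "0 < l"
  shows "finite {s. 1 / l \<le> \<bar>y s\<bar>}" "real (card {s. 1 / l \<le> \<bar>y s\<bar>}) \<le> l powr p"
proof -
  have "real (card H) \<le> l powr p" if H: "finite H" "H \<subseteq> {s. 1 / l \<le> \<bar>y s\<bar>}" for H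
  proof -
    have "real (card H) * (1 / l) powr p = (\<Sum>s\<in>H. (1 / l) powr p)" by simp
    also have "\<dots> \<le> (\<Sum>s\<in>H. \<bar>y s\<bar> powr p)"
      using H l p by (intro sum_mono powr_mono2) auto
    also have "\<dots> \<le> 1" by (rule sum_powr_le_1[OF y(1) H(1) y(2)])
    finally show ?thesis using l by (simp add: powr_divide field_simps)
  qed
  then show "finite {s. 1 / l \<le> \<bar>y s\<bar>}" "real (card {s. 1 / l \<le> \<bar>y s\<bar>}) \<le> l powr p"
    using finite_card_le_of_finite_subsets[of "l powr p" "{s. 1 / l \<le> \<bar>y s\<bar>}"] by auto
qed

section \<open>The operators defined by sets of levels\<close>

lemma lp_add:
  assumes "x \<in> vecs (lp p)" "y \<in> vecs (lp p)"
  shows "(\<lambda>n. x n + y n) \<in> vecs (lp p)"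
proof -
  have "\<bar>x n + y n\<bar> powr p \<le> 2 powr p * (\<bar>x n\<bar> powr p + \<bar>y n\<bar> powr p)" for n
  proof -
    have "\<bar>x n + y n\<bar> powr p \<le> (2 * max \<bar>x n\<bar> \<bar>y n\<bar>) powr p"
      using p by (intro powr_mono2) auto
    also have "\<dots> = 2 powr p * max \<bar>x n\<bar> \<bar>y n\<bar> powr p" by (simp add: powr_mult)
    also have "\<dots> \<le> 2 powr p * (\<bar>x n\<bar> powr p + \<bar>y n\<bar> powr p)"
      by (intro mult_left_mono) (auto simp: max_def)
    finally show ?thesis .
  qed
  then have le: "norm (\<bar>x n + y n\<bar> powr p) \<le> 2 powr p * (\<bar>x n\<bar> powr p + \<bar>y n\<bar> powr p)" for n
    by simp
  have "summable (\<lambda>n. 2 powr p * (\<bar>x n\<bar> powr p + \<bar>y n\<bar> powr p))"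
    using assms by (intro summable_mult summable_add) auto
  then have "summable (\<lambda>n. \<bar>x n + y n\<bar> powr p)"
    by (rule summable_comparison_test') (rule le)
  then show ?thesis by simp
qed

lemma lp_scale:
  assumes "x \<in> vecs (lp p)"
  shows "(\<lambda>n. c * x n) \<in> vecs (lp p)"
  using assms by (auto simp: abs_mult powr_mult intro: summable_mult)

definition line_op :: "nat set \<Rightarrow> real_seq \<Rightarrow> real_seq" where
  "line_op M x = (\<lambda>c. if x \<in> vecs (lp p) \<and> level c \<in> M then \<phi> c x else 0)"

lemma line_op_le_nrm:
  assumes "x \<in> vecs (lp p)"
  shows "nrm c0 (line_op M x) \<le> nrm (lp p) x"
proof (rule nrm_c0_le)
  fix c
  have "\<bar>\<phi> c x\<bar> \<le> nrm (lp p) x"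
    using contractive_functional_\<phi>[of c] assms unfolding contractive_functional_def by blast
  then show "\<bar>line_op M x c\<bar> \<le> nrm (lp p) x"
    using nrm_lp_nonneg[of x] by (auto simp: line_op_def)
qed

lemma line_op_operator: "line_op M \<in> operators (lp p) c0"
proof -
  have "line_op M x \<in> vecs c0" for x
  proof (cases "x \<in> vecs (lp p)")
    case True
    have "\<bar>line_op M x c\<bar> \<le> \<bar>\<phi> c x\<bar>" for c by (simp add: line_op_def)
    then have "line_op M x \<longlonglongrightarrow> 0"
      by (intro Lim_null_comparison[OF _ tendsto_rabs_zero[OF \<phi>_tendsto_0[OF True]]]) simp
    then show ?thesis by simp
  qed (simp add: line_op_def del: vecs_lp)
  moreover have "line_op M (\<lambda>n. x n + y n) = (\<lambda>n. line_op M x n + line_op M y n)" if "x \<in> vecs (lp p)" "y \<in> vecs (lp p)" for x y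
  proof
    fix c
    show "line_op M (\<lambda>n. x n + y n) c = line_op M x c + line_op M y c"
      using that lp_add[OF that] contractive_functional_\<phi>[of c]
      by (simp add: line_op_def contractive_functional_def del: vecs_lp)
  qed
  moreover have "line_op M (\<lambda>n. c * x n) = (\<lambda>n. c * line_op M x n)" if "x \<in> vecs (lp p)" for x c
  proof
    fix d
    show "line_op M (\<lambda>n. c * x n) d = c * line_op M x d"
      using that lp_scale[OF that] contractive_functional_\<phi>[of d]
      by (simp add: line_op_def contractive_functional_def del: vecs_lp)
  qed
  moreover have "\<forall>x\<in>vecs (lp p). nrm c0 (line_op M x) \<le> 1 * nrm (lp p) x"
    using line_op_le_nrm by simp
  then have "\<exists>C. \<forall>x\<in>vecs (lp p). nrm c0 (line_op M x) \<le> C * nrm (lp p) x" by blast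
  moreover have "line_op M x = (\<lambda>n. 0)" if "x \<notin> vecs (lp p)" for x
    using that by (simp add: line_op_def del: vecs_lp)
  ultimately show ?thesis unfolding operators_def by blast
qed

section \<open>Averages over the lines of a level\<close>

definition avg :: "nat \<Rightarrow> (real_seq \<Rightarrow> real_seq) \<Rightarrow> real" where
  "avg n S = (\<Sum>c\<in>lines n. nrm c0 (S (flat_vec c))) / real (card (lines n))"

lemma card_lines_pos: "0 < real (card (lines n))"
  using side_pos[of n] by (simp add: card_lines)

lemma avg_le:
  assumes "\<And>c. c \<in> lines n \<Longrightarrow> nrm c0 (S (flat_vec c)) \<le> k * nrm c0 (U (flat_vec c)) + e"
  shows "avg n S \<le> k * avg n U + e"
proof -
  have "(\<Sum>c\<in>lines n. nrm c0 (S (flat_vec c))) \<le> (\<Sum>c\<in>lines n. k * nrm c0 (U (flat_vec c)) + e)"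
    by (rule sum_mono) (rule assms)
  also have "\<dots> = k * (\<Sum>c\<in>lines n. nrm c0 (U (flat_vec c))) + real (card (lines n)) * e"
    by (simp add: sum.distrib sum_distrib_left)
  finally show ?thesis
    using card_lines_pos[of n] by (simp add: avg_def field_simps)
qed

lemma avg_nonneg:
  assumes "\<And>c. c \<in> lines n \<Longrightarrow> S (flat_vec c) \<in> vecs c0"
  shows "0 \<le> avg n S"
  unfolding avg_def using nrm_c0_nonneg[OF assms] by (intro divide_nonneg_nonneg sum_nonneg) auto

text \<open>On lines outside two exceptional sets every coordinate of the image is at most
  \<open>\<delta>\<close>. The exceptional lines have a share of at most \<open>1 / 2 ^ n\<close>,
  and contractivity bounds each of their terms by 1.\<close>

lemma avg_line_op_le:
  assumes B: "lp_contraction B" and n: "n \<notin> M"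
  shows "avg n (line_op M \<circ> B) \<le> 2 * (1 / 2 ^ n) powr (1 / p) + 1 / 2 ^ n"
proof -
  define l where "l = real (len n)"
  define \<delta> where "\<delta> = 2 * (1 / 2 ^ n) powr (1 / p)"
  have \<delta>0: "0 \<le> \<delta>" by (simp add: \<delta>_def)
  have l: "0 < l" using len_pos by (simp add: l_def)
  have Bx: "B x \<in> vecs (lp p)" "nrm (lp p) (B x) \<le> 1" if "x \<in> vecs (lp p)" "nrm (lp p) x \<le> 1" for x
    using B that unfolding lp_contraction_def by force+
  have B_unit: "B (unit_vec x) \<in> vecs (lp p)" "nrm (lp p) (B (unit_vec x)) \<le> 1" for x
    using Bx[of "unit_vec x"] fin_vec_mem[of "{x}"] nrm_fin_vec[of "{x}"] by (simp_all del: vecs_lp)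
  have B_flat: "B (flat_vec c) \<in> vecs (lp p)" "nrm (lp p) (B (flat_vec c)) \<le> 1" for c
    using Bx[of "flat_vec c"] flat_vec_mem nrm_flat_vec by (simp_all del: vecs_lp)
  \<comment> \<open>\<open>E1\<close> is tied to the coordinates of \<open>B\<close>, which serve
    for lines \<open>d\<close> of lower level; \<open>E2\<close> is tied to the functionals of lines
    of higher level.\<close>
  define E1 where "E1 = {c\<in>lines n. \<exists>s\<in>UNIV. 2 * l powr (- (1 / p)) < \<bar>B (flat_vec c) s\<bar>}"
  define E2 where "E2 = {c\<in>lines n. \<exists>d\<in>{d. n < level d}. 2 * l powr (- (1 / p)) < \<bar>\<phi> d (B (flat_vec c))\<bar>}"
  have "2 * l * real (card E1) \<le> real (card (lines n))"
    unfolding E1_def l_def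
  proof (rule card_large_on_flat_vec)
    fix x
    have "l powr p \<le> (2 * l) powr p" using l p by (intro powr_mono2) auto
    then show "finite {r \<in> UNIV. 1 / real (len n) \<le> \<bar>B (unit_vec x) r\<bar>} \<and>
      real (card {r \<in> UNIV. 1 / real (len n) \<le> \<bar>B (unit_vec x) r\<bar>}) \<le> (2 * real (len n)) powr p"
      using card_large_coords[OF B_unit l, of x] by (simp add: l_def)
  qed (rule contractive_functional_comp[OF contractive_functional_coord B])
  moreover have "2 * l * real (card E2) \<le> real (card (lines n))"
    unfolding E2_def l_def
  proof (rule card_large_on_flat_vec)
    fix x
    show "finite {r \<in> {d. n < level d}. 1 / real (len n) \<le> \<bar>\<phi> r (B (unit_vec x))\<bar>} \<and>
      real (card {r \<in> {d. n < level d}. 1 / real (len n) \<le> \<bar>\<phi> r (B (unit_vec x))\<bar>}) \<le> (2 * real (len n)) powr p"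
      using card_large_\<phi>[OF B_unit, of n x] by simp
  qed (rule contractive_functional_comp[OF contractive_functional_\<phi> B])
  moreover have "real (card (E1 \<union> E2)) \<le> real (card E1) + real (card E2)"
    using card_Un_le[of E1 E2] by linarith
  ultimately have "l * real (card (E1 \<union> E2)) \<le> real (card (lines n))"
    using mult_left_mono[of "real (card (E1 \<union> E2))" "real (card E1) + real (card E2)" l] l
    by (simp add: algebra_simps)
  moreover have "2 ^ n \<le> l" using pow2_le_len[of n] by (simp add: l_def)
  ultimately have cardE: "2 ^ n * real (card (E1 \<union> E2)) \<le> real (card (lines n))"
    by (meson mult_right_mono of_nat_0_le_iff order_trans)
  have l_le: "2 * l powr (- (1 / p)) \<le> \<delta>"
  proof -
    have "l powr (- (1 / p)) = (1 / l) powr (1 / p)"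
      using l by (simp add: powr_minus_divide powr_divide)
    also have "\<dots> \<le> (1 / 2 ^ n) powr (1 / p)"
      using p l \<open>2 ^ n \<le> l\<close> by (intro powr_mono2) (auto simp: frac_le)
    finally show ?thesis by (simp add: \<delta>_def)
  qed
  have good: "nrm c0 (line_op M (B (flat_vec c))) \<le> \<delta>" if c: "c \<in> lines n - (E1 \<union> E2)" for c
  proof (rule nrm_c0_le)
    fix d
    define y where "y = B (flat_vec c)"
    have y1: "\<bar>y s\<bar> \<le> 2 * l powr (- (1 / p))" for s
      using c by (auto simp: E1_def y_def not_less)
    have y2: "\<bar>\<phi> d y\<bar> \<le> 2 * l powr (- (1 / p))" if "n < level d"
      by (rule ccontr) (use c that in \<open>auto simp: E2_def y_def\<close>)
    \<comment> \<open>Level \<open>n\<close> itself falls under the first case because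
      \<open>n \<notin> M\<close>; there the coordinate is 0.\<close>
    consider "level d \<notin> M" | "n < level d" | "level d < n"
      using n by (metis linorder_neqE_nat)
    then have "\<bar>line_op M y d\<bar> \<le> \<delta>"
    proof cases
      case 1
      then show ?thesis using \<delta>0 by (simp add: line_op_def)
    next
      case 2
      then show ?thesis using y2 l_le \<delta>0 by (auto simp: line_op_def)
    next
      case 3
      define k where "k = real (len (level d))"
      have k: "0 < k" using len_pos by (simp add: k_def)
      \<comment> \<open>Adding up the bound for the \<open>k\<close> coordinates on the line gives
        \<open>2 * (k / l) powr (1 / p)\<close> after normalisation.\<close>
      have "\<bar>\<Sum>s\<in>line len d. y s\<bar> \<le> (\<Sum>s\<in>line len d. 2 * l powr (- (1 / p)))"
        by (rule order_trans[OF sum_abs sum_mono]) (rule y1)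
      also have "\<dots> = k * (2 * l powr (- (1 / p)))"
        by (simp add: k_def)
      finally have "\<bar>\<phi> d y\<bar> \<le> k powr (1 / p - 1) * (k * (2 * l powr (- (1 / p))))"
        by (simp add: \<phi>_def abs_mult k_def mult_left_mono)
      also have "\<dots> = 2 * (k / l) powr (1 / p)"
        using k l by (simp add: powr_diff powr_divide powr_minus_divide)
      also have "\<dots> \<le> \<delta>"
      proof -
        have "k * 2 ^ n \<le> l"
          using of_nat_mono[OF len_mult_pow2_le[OF 3], where 'a = real] by (simp add: k_def l_def)
        then have "k / l \<le> 1 / 2 ^ n" using l by (simp add: field_simps)
        then show ?thesis
          unfolding \<delta>_def using p k l by (intro mult_left_mono powr_mono2) auto
      qed
      finally show ?thesis using \<delta>0 by (simp add: line_op_def)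
    qed
    then show "\<bar>line_op M (B (flat_vec c)) d\<bar> \<le> \<delta>" by (simp add: y_def)
  qed
  have le1: "nrm c0 (line_op M (B (flat_vec c))) \<le> 1" for c
    using line_op_le_nrm[OF B_flat(1), of M c] B_flat(2)[of c] by simp
  have sub: "E1 \<union> E2 \<subseteq> lines n" by (auto simp: E1_def E2_def)
  have "(\<Sum>c\<in>lines n. nrm c0 ((line_op M \<circ> B) (flat_vec c))) =
    (\<Sum>c\<in>lines n - (E1 \<union> E2). nrm c0 (line_op M (B (flat_vec c)))) + (\<Sum>c\<in>E1 \<union> E2. nrm c0 (line_op M (B (flat_vec c))))"
    using sum.subset_diff[OF sub] by simp
  also have "\<dots> \<le> (\<Sum>c\<in>lines n - (E1 \<union> E2). \<delta>) + (\<Sum>c\<in>E1 \<union> E2. 1)"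
    using good le1 by (intro add_mono sum_mono) auto
  also have "\<dots> \<le> real (card (lines n)) * \<delta> + real (card (lines n)) / 2 ^ n"
  proof (rule add_mono)
    show "(\<Sum>c\<in>lines n - (E1 \<union> E2). \<delta>) \<le> real (card (lines n)) * \<delta>"
      using card_mono[of "lines n" "lines n - (E1 \<union> E2)"] by (auto simp: \<delta>_def intro!: mult_right_mono)
    show "(\<Sum>c\<in>E1 \<union> E2. 1) \<le> real (card (lines n)) / 2 ^ n"
      using cardE by (simp add: field_simps)
  qed
  finally show ?thesis
    using card_lines_pos[of n] by (simp add: avg_def \<delta>_def[symmetric] field_simps)
qed

section \<open>The closed ideals\<close>

text \<open>The value 0 on \<open>M\<close> expresses a limit along the levels outside
  \<open>M\<close>. Quantifying over all contractions \<open>B\<close> yields stability under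
  composition from the right.\<close>

definition line_ideal :: "nat set \<Rightarrow> (real_seq \<Rightarrow> real_seq) set" where
  "line_ideal M = {S \<in> operators (lp p) c0. \<forall>B. lp_contraction B \<longrightarrow>
     (\<lambda>n. if n \<in> M then 0 else avg n (S \<circ> B)) \<longlonglongrightarrow> 0}"

lemma contraction_flat_vec:
  assumes "lp_contraction B"
  shows "B (flat_vec c) \<in> vecs (lp p)" "nrm (lp p) (B (flat_vec c)) \<le> 1"
  using assms flat_vec_mem[of c] nrm_flat_vec[of c] unfolding lp_contraction_def by force+

lemma operator_contraction_mem:
  assumes "S \<in> operators (lp p) c0" "lp_contraction B"
  shows "S (B (flat_vec c)) \<in> vecs c0"
  using operatorsD(1)[OF assms(1) contraction_flat_vec(1)[OF assms(2)]] .

lemma line_idealI: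
  assumes S: "S \<in> operators (lp p) c0"
    and lim: "\<And>B. lp_contraction B \<Longrightarrow> \<exists>f. (\<forall>n. n \<notin> M \<longrightarrow> avg n (S \<circ> B) \<le> f n) \<and> f \<longlonglongrightarrow> 0"
  shows "S \<in> line_ideal M"
proof -
  have "(\<lambda>n. if n \<in> M then 0 else avg n (S \<circ> B)) \<longlonglongrightarrow> 0" if B: "lp_contraction B" for B
  proof -
    obtain f where f: "\<And>n. n \<notin> M \<Longrightarrow> avg n (S \<circ> B) \<le> f n" "f \<longlonglongrightarrow> 0"
      using lim[OF B] by blast
    have "norm (if n \<in> M then 0 else avg n (S \<circ> B)) \<le> \<bar>f n\<bar>" for n
      using f(1)[of n] avg_nonneg[of n "S \<circ> B"] operator_contraction_mem[OF S B] by auto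
    then show ?thesis
      by (intro Lim_null_comparison[OF _ tendsto_rabs_zero[OF f(2)]]) simp
  qed
  then show ?thesis using S by (simp add: line_ideal_def)
qed

lemma line_idealD:
  assumes "S \<in> line_ideal M"
  shows "S \<in> operators (lp p) c0"
    and "lp_contraction B \<Longrightarrow> (\<lambda>n. if n \<in> M then 0 else avg n (S \<circ> B)) \<longlonglongrightarrow> 0"
  using assms by (auto simp: line_ideal_def)

lemma line_op_mem_line_ideal: "line_op M \<in> line_ideal M"
proof (rule line_idealI[OF line_op_operator])
  fix B assume "lp_contraction B"
  then have "\<forall>n. n \<notin> M \<longrightarrow> avg n (line_op M \<circ> B) \<le> 2 * (1 / 2 ^ n) powr (1 / p) + 1 / 2 ^ n"
    using avg_line_op_le by blast
  moreover have "(\<lambda>n. 2 * (1 / 2 ^ n) powr (1 / p) + 1 / 2 ^ n :: real) \<longlonglongrightarrow> 0"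
  proof -
    have *: "(\<lambda>n. 1 / 2 ^ n :: real) \<longlonglongrightarrow> 0"
      using LIMSEQ_realpow_zero[of "1 / 2"] by (simp add: power_divide)
    have "(\<lambda>n. (1 / 2 ^ n :: real) powr (1 / p)) \<longlonglongrightarrow> 0"
      using p by (intro tendsto_zero_powrI[OF * tendsto_const]) auto
    then show ?thesis
      using tendsto_add[OF tendsto_mult_right_zero[of _ _ 2] *] by simp
  qed
  ultimately show "\<exists>f. (\<forall>n. n \<notin> M \<longrightarrow> avg n (line_op M \<circ> B) \<le> f n) \<and> f \<longlonglongrightarrow> 0"
    by (intro exI conjI)
qed

lemma lp_contraction_id: "lp_contraction (\<lambda>x. x)"
  by (simp add: lp_contraction_def)

text \<open>Test with the identity as contraction: for a line \<open>c\<close> of level in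
  \<open>M'\<close>, coordinate \<open>c\<close> of the image of \<open>flat_vec c\<close> is 1, so
  the averages are at least 1 at infinitely many levels outside \<open>M\<close>.\<close>

lemma line_op_not_mem_line_ideal:
  assumes "infinite (M' - M)"
  shows "line_op M' \<notin> line_ideal M"
proof
  assume "line_op M' \<in> line_ideal M"
  then have lim: "(\<lambda>n. if n \<in> M then 0 else avg n (line_op M' \<circ> (\<lambda>x. x))) \<longlonglongrightarrow> 0"
    using lp_contraction_id by (rule line_idealD(2))
  have ge: "1 \<le> avg n (line_op M' \<circ> (\<lambda>x. x))" if n: "n \<in> M'" for n
  proof -
    have "1 \<le> nrm c0 (line_op M' (flat_vec c))" if c: "c \<in> lines n" for c
    proof -
      have "line_op M' (flat_vec c) c = 1"
        using n c flat_vec_mem[of c] by (simp add: line_op_def \<phi>_flat_vec lines_def del: vecs_lp)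
      then show ?thesis
        using abs_le_nrm_c0[OF operatorsD(1)[OF line_op_operator flat_vec_mem], of M' c c] by simp
    qed
    then have "(\<Sum>c\<in>lines n. 1) \<le> (\<Sum>c\<in>lines n. nrm c0 (line_op M' (flat_vec c)))"
      by (rule sum_mono)
    then show ?thesis using card_lines_pos[of n] by (simp add: avg_def)
  qed
  have "\<forall>\<^sub>F n in sequentially. (if n \<in> M then 0 else avg n (line_op M' \<circ> (\<lambda>x. x))) < 1"
    using order_tendstoD(2)[OF lim, of 1] by simp
  then obtain N where "\<And>n. n \<ge> N \<Longrightarrow> (if n \<in> M then 0 else avg n (line_op M' \<circ> (\<lambda>x. x))) < 1"
    unfolding eventually_sequentially by blast
  then have "n < N" if "n \<in> M' - M" for n
    using ge[of n] that by (metis DiffD1 DiffD2 linorder_not_less)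
  then have "M' - M \<subseteq> {..<N}" by blast
  then show False using assms finite_subset by blast
qed

lemma operator_comp:
  assumes A: "A \<in> operators c0 c0" and S: "S \<in> operators (lp p) c0" and B: "B \<in> operators (lp p) (lp p)"
  shows "A \<circ> S \<circ> B \<in> operators (lp p) c0"
proof -
  have Bx: "B x \<in> vecs (lp p)" if "x \<in> vecs (lp p)" for x
    using operatorsD(1)[OF B that] .
  have Sx: "S x \<in> vecs c0" if "x \<in> vecs (lp p)" for x
    using operatorsD(1)[OF S that] .
  obtain CA CS CB where
    CA: "\<And>x. x \<in> vecs c0 \<Longrightarrow> nrm c0 (A x) \<le> CA * nrm c0 x" and
    CS: "\<And>x. x \<in> vecs (lp p) \<Longrightarrow> nrm c0 (S x) \<le> CS * nrm (lp p) x" and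
    CB: "\<And>x. x \<in> vecs (lp p) \<Longrightarrow> nrm (lp p) (B x) \<le> CB * nrm (lp p) x"
    using operatorsD(4)[OF A] operatorsD(4)[OF S] operatorsD(4)[OF B] by blast
  have "nrm c0 (A (S (B x))) \<le> (\<bar>CA\<bar> * (\<bar>CS\<bar> * \<bar>CB\<bar>)) * nrm (lp p) x" if x: "x \<in> vecs (lp p)" for x
  proof -
    have "nrm c0 (A (S (B x))) \<le> \<bar>CA\<bar> * nrm c0 (S (B x))"
      using CA[OF Sx[OF Bx[OF x]]] nrm_c0_nonneg[OF Sx[OF Bx[OF x]]]
      by (meson abs_ge_self mult_right_mono order_trans)
    also have "nrm c0 (S (B x)) \<le> \<bar>CS\<bar> * nrm (lp p) (B x)"
      using CS[OF Bx[OF x]] nrm_lp_nonneg[of "B x"]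
      by (meson abs_ge_self mult_right_mono order_trans)
    also have "nrm (lp p) (B x) \<le> \<bar>CB\<bar> * nrm (lp p) x"
      using CB[OF x] nrm_lp_nonneg[of x]
      by (meson abs_ge_self mult_right_mono order_trans)
    finally show ?thesis by (simp add: mult.assoc mult_left_mono)
  qed
  then have "\<exists>C. \<forall>x\<in>vecs (lp p). nrm c0 ((A \<circ> S \<circ> B) x) \<le> C * nrm (lp p) x"
    unfolding comp_apply by blast
  moreover have "(A \<circ> S \<circ> B) x = (\<lambda>n. 0)" if "x \<notin> vecs (lp p)" for x
  proof -
    have z: "(\<lambda>n. 0) \<in> vecs (lp p)" using zero_in_unit_ball by blast
    have "S (\<lambda>n. 0) = (\<lambda>n. 0)" using operatorsD(3)[OF S z, of 0] by simp
    moreover have "A (\<lambda>n. 0) = (\<lambda>n. 0)" using operatorsD(3)[OF A, of "\<lambda>n. 0" 0] by simp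
    ultimately show ?thesis using operatorsD(5)[OF B that] by simp
  qed
  moreover have "(A \<circ> S \<circ> B) (\<lambda>n. x n + y n) = (\<lambda>n. (A \<circ> S \<circ> B) x n + (A \<circ> S \<circ> B) y n)"
    if "x \<in> vecs (lp p)" "y \<in> vecs (lp p)" for x y
    unfolding comp_apply
    by (simp only: operatorsD(2)[OF B that] operatorsD(2)[OF S Bx[OF that(1)] Bx[OF that(2)]]
        operatorsD(2)[OF A Sx[OF Bx[OF that(1)]] Sx[OF Bx[OF that(2)]]])
  moreover have "(A \<circ> S \<circ> B) (\<lambda>n. c * x n) = (\<lambda>n. c * (A \<circ> S \<circ> B) x n)"
    if "x \<in> vecs (lp p)" for c x
    unfolding comp_apply
    by (simp only: operatorsD(3)[OF B that] operatorsD(3)[OF S Bx[OF that]] operatorsD(3)[OF A Sx[OF Bx[OF that]]])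
  moreover have "(A \<circ> S \<circ> B) x \<in> vecs c0" if "x \<in> vecs (lp p)" for x
    unfolding comp_apply by (rule operatorsD(1)[OF A Sx[OF Bx[OF that]]])
  ultimately show ?thesis unfolding operators_def by blast
qed

lemma zero_operator: "(\<lambda>x n. 0) \<in> operators (lp p) c0"
  using op_diff_mem[OF line_op_operator[of UNIV] line_op_operator[of UNIV]] by simp

lemma line_ideal_add:
  assumes S: "S \<in> line_ideal M" and U: "U \<in> line_ideal M"
  shows "(\<lambda>x n. S x n + U x n) \<in> line_ideal M"
proof (rule line_idealI)
  \<comment> \<open>The sum is written as a difference so that \<open>op_diff_mem\<close>
    applies.\<close>
  have "(\<lambda>x n. S x n - (0 - U x n)) \<in> operators (lp p) c0"
    using op_diff_mem[OF line_idealD(1)[OF S] op_diff_mem[OF zero_operator line_idealD(1)[OF U]]] .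
  then show "(\<lambda>x n. S x n + U x n) \<in> operators (lp p) c0" by simp
next
  fix B assume B: "lp_contraction B"
  have "avg n ((\<lambda>x n. S x n + U x n) \<circ> B) \<le> avg n (S \<circ> B) + avg n (U \<circ> B)" for n
  proof -
    have "nrm c0 (\<lambda>n. S (B (flat_vec c)) n + U (B (flat_vec c)) n)
      \<le> nrm c0 (S (B (flat_vec c))) + nrm c0 (U (B (flat_vec c)))" for c
      using abs_le_nrm_c0[OF operator_contraction_mem[OF line_idealD(1)[OF S] B]]
        abs_le_nrm_c0[OF operator_contraction_mem[OF line_idealD(1)[OF U] B]]
      by (intro nrm_c0_le order_trans[OF abs_triangle_ineq add_mono])
    then show ?thesis
      by (simp add: avg_def add_divide_distrib[symmetric] sum.distrib[symmetric] divide_right_mono sum_mono)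
  qed
  then have "\<forall>n. n \<notin> M \<longrightarrow> avg n ((\<lambda>x n. S x n + U x n) \<circ> B) \<le>
    (if n \<in> M then 0 else avg n (S \<circ> B)) + (if n \<in> M then 0 else avg n (U \<circ> B))" by simp
  then show "\<exists>f. (\<forall>n. n \<notin> M \<longrightarrow> avg n ((\<lambda>x n. S x n + U x n) \<circ> B) \<le> f n) \<and> f \<longlonglongrightarrow> 0"
    using tendsto_add_zero[OF line_idealD(2)[OF S B] line_idealD(2)[OF U B]] by (intro exI conjI)
qed

text \<open>After division by a constant \<open>k\<close>, the composite of \<open>B'\<close> with a
  contraction \<open>B\<close> is a contraction \<open>D\<close> again. Hence the averages for the
  composite are at most \<open>\<bar>CA\<bar> * k\<close> times those of
  \<open>S \<circ> D\<close>.\<close>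

lemma line_ideal_comp:
  assumes A: "A \<in> operators c0 c0" and S: "S \<in> line_ideal M" and B': "B' \<in> operators (lp p) (lp p)"
  shows "A \<circ> S \<circ> B' \<in> line_ideal M"
proof (rule line_idealI[OF operator_comp[OF A line_idealD(1)[OF S] B']])
  fix B assume B: "lp_contraction B"
  obtain CA where CA: "\<And>x. x \<in> vecs c0 \<Longrightarrow> nrm c0 (A x) \<le> CA * nrm c0 x"
    using operatorsD(4)[OF A] by blast
  obtain C where C: "\<And>x. x \<in> vecs (lp p) \<Longrightarrow> nrm (lp p) (B' x) \<le> C * nrm (lp p) x"
    using operatorsD(4)[OF B'] by blast
  \<comment> \<open>Adding 1 keeps the divisor positive even for \<open>C = 0\<close>.\<close>
  define k where "k = \<bar>C\<bar> + 1"
  have k: "0 < k" by (simp add: k_def)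
  define D where "D x = (\<lambda>n. (1 / k) * B' (B x) n)" for x
  have Bx: "B x \<in> vecs (lp p)" "nrm (lp p) (B x) \<le> nrm (lp p) x" if "x \<in> vecs (lp p)" for x
    using B that unfolding lp_contraction_def by blast+
  have mem: "B' (B x) \<in> vecs (lp p)" if "x \<in> vecs (lp p)" for x
    using operatorsD(1)[OF B' Bx(1)[OF that]] .
  have D: "lp_contraction D"
  proof -
    have "nrm (lp p) (D x) \<le> nrm (lp p) x" if x: "x \<in> vecs (lp p)" for x
    proof -
      have "nrm (lp p) (B' (B x)) \<le> C * nrm (lp p) (B x)" by (rule C[OF Bx(1)[OF x]])
      also have "\<dots> \<le> k * nrm (lp p) x"
        using Bx(2)[OF x] nrm_lp_nonneg k by (intro mult_mono) (auto simp: k_def)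
      finally have "nrm (lp p) (B' (B x)) / k \<le> nrm (lp p) x"
        using k by (simp add: field_simps)
      then show ?thesis
        unfolding D_def using nrm_lp_scale[OF _ mem[OF x], of "1 / k"] p k by simp
    qed
    moreover have "D x \<in> vecs (lp p)" if "x \<in> vecs (lp p)" for x
      unfolding D_def by (rule lp_scale[OF mem[OF that]])
    moreover have "D (\<lambda>n. x n + y n) = (\<lambda>n. D x n + D y n)" if "x \<in> vecs (lp p)" "y \<in> vecs (lp p)" for x y
    proof -
      have "B (\<lambda>n. x n + y n) = (\<lambda>n. B x n + B y n)"
        using B that unfolding lp_contraction_def by blast
      then show ?thesis
        unfolding D_def by (simp add: operatorsD(2)[OF B' Bx(1)[OF that(1)] Bx(1)[OF that(2)]] distrib_left)
    qed
    moreover have "D (\<lambda>n. c * x n) = (\<lambda>n. c * D x n)" if "x \<in> vecs (lp p)" for c x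
    proof -
      have "B (\<lambda>n. c * x n) = (\<lambda>n. c * B x n)"
        using B that unfolding lp_contraction_def by blast
      then show ?thesis
        unfolding D_def by (simp add: operatorsD(3)[OF B' Bx(1)[OF that]] mult.left_commute)
    qed
    ultimately show ?thesis unfolding lp_contraction_def by blast
  qed
  have le: "avg n (A \<circ> S \<circ> B' \<circ> B) \<le> \<bar>CA\<bar> * k * avg n (S \<circ> D)" for n
  proof -
    have "nrm c0 (A (S (B' (B (flat_vec c))))) \<le> \<bar>CA\<bar> * k * nrm c0 (S (D (flat_vec c)))" for c
    proof -
      define u where "u = flat_vec c"
      have u: "u \<in> vecs (lp p)" using flat_vec_mem by (simp add: u_def del: vecs_lp)
      have SD: "S (D u) \<in> vecs c0"
        using operator_contraction_mem[OF line_idealD(1)[OF S] D] by (simp add: u_def del: vecs_c0)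
      have "B' (B u) = (\<lambda>n. k * D u n)" using k by (simp add: D_def)
      moreover have "D u \<in> vecs (lp p)"
        using contraction_flat_vec(1)[OF D] by (simp add: u_def del: vecs_lp)
      ultimately have eq: "S (B' (B u)) = (\<lambda>n. k * S (D u) n)"
        using operatorsD(3)[OF line_idealD(1)[OF S], of "D u" k] by simp
      have mem': "S (B' (B u)) \<in> vecs c0" by (rule operatorsD(1)[OF line_idealD(1)[OF S] mem[OF u]])
      have "nrm c0 (A (S (B' (B u)))) \<le> \<bar>CA\<bar> * nrm c0 (S (B' (B u)))"
        using CA[OF mem'] nrm_c0_nonneg[OF mem'] by (meson abs_ge_self mult_right_mono order_trans)
      also have "\<dots> \<le> \<bar>CA\<bar> * (k * nrm c0 (S (D u)))"
        using nrm_c0_scale_le[OF SD, of k] k unfolding eq by (intro mult_left_mono) auto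
      finally show ?thesis by (simp add: u_def)
    qed
    then show ?thesis using avg_le[of n "A \<circ> S \<circ> B' \<circ> B" "\<bar>CA\<bar> * k" "S \<circ> D" 0] by simp
  qed
  have "\<forall>n. n \<notin> M \<longrightarrow> avg n (A \<circ> S \<circ> B' \<circ> B) \<le> \<bar>CA\<bar> * k * (if n \<in> M then 0 else avg n (S \<circ> D))"
    using le by simp
  then show "\<exists>f. (\<forall>n. n \<notin> M \<longrightarrow> avg n (A \<circ> S \<circ> B' \<circ> B) \<le> f n) \<and> f \<longlonglongrightarrow> 0"
    using tendsto_mult_right_zero[OF line_idealD(2)[OF S D], of "\<bar>CA\<bar> * k"] by (intro exI conjI)
qed

text \<open>The vectors \<open>B (flat_vec c)\<close> lie in the unit ball, so an approximation of
  \<open>S\<close> by \<open>U\<close> within \<open>\<epsilon> / 2\<close> raises all averages by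
  at most \<open>\<epsilon> / 2\<close>, uniformly in the level.\<close>

lemma closedin_line_ideal:
  "closedin (Metric_space.mtopology (operators (lp p) c0) (op_dist (lp p) c0)) (line_ideal M)"
proof -
  interpret Metric_space "operators (lp p) c0" "op_dist (lp p) c0"
    by (rule Metric_space_operators) (use p in simp)
  have "S \<in> line_ideal M" if S: "S \<in> operators (lp p) c0"
    and near: "\<And>r. 0 < r \<Longrightarrow> \<exists>U\<in>line_ideal M. op_dist (lp p) c0 S U < r" for S
  proof -
    have "(\<lambda>n. if n \<in> M then 0 else avg n (S \<circ> B)) \<longlonglongrightarrow> 0" if B: "lp_contraction B" for B
    proof (rule LIMSEQ_I)
      fix \<epsilon> :: real
      assume \<epsilon>: "0 < \<epsilon>"
      obtain U where U: "U \<in> line_ideal M" and d: "op_dist (lp p) c0 S U < \<epsilon> / 2"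
        using near[of "\<epsilon> / 2"] \<epsilon> by auto
      note Uop = line_idealD(1)[OF U]
      have *: "avg n (S \<circ> B) \<le> avg n (U \<circ> B) + \<epsilon> / 2" for n
      proof -
        have "nrm c0 (S (B (flat_vec c))) \<le> nrm c0 (U (B (flat_vec c))) + \<epsilon> / 2" for c
        proof (rule nrm_c0_le)
          fix m
          let ?y = "B (flat_vec c)"
          have "\<bar>S ?y m - U ?y m\<bar> \<le> nrm c0 (\<lambda>n. S ?y n - U ?y n)"
            using abs_le_nrm_c0[OF operator_contraction_mem[OF op_diff_mem[OF S Uop] B]] .
          also have "\<dots> \<le> op_norm (lp p) c0 (\<lambda>x n. S x n - U x n)"
            using nrm_le_op_norm[OF op_diff_mem[OF S Uop] contraction_flat_vec[OF B]] .
          also have "\<dots> < \<epsilon> / 2" using d S Uop by (simp add: op_dist_def)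
          finally show "\<bar>S ?y m\<bar> \<le> nrm c0 (U ?y) + \<epsilon> / 2"
            using abs_le_nrm_c0[OF operator_contraction_mem[OF Uop B], of c m] by linarith
        qed
        then show ?thesis using avg_le[of n "S \<circ> B" 1 "U \<circ> B" "\<epsilon> / 2"] by simp
      qed
      obtain N where N: "\<And>n. n \<ge> N \<Longrightarrow> norm ((if n \<in> M then 0 else avg n (U \<circ> B)) - 0) < \<epsilon> / 2"
        using LIMSEQ_D[OF line_idealD(2)[OF U B], of "\<epsilon> / 2"] \<epsilon> by auto
      have "norm ((if n \<in> M then 0 else avg n (S \<circ> B)) - 0) < \<epsilon>" if "n \<ge> N" for n
        using N[OF that] *[of n] \<epsilon> avg_nonneg[of n "S \<circ> B"] operator_contraction_mem[OF S B]
        by (auto split: if_splits)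
      then show "\<exists>no. \<forall>n\<ge>no. norm ((if n \<in> M then 0 else avg n (S \<circ> B)) - 0) < \<epsilon>" by blast
    qed
    then show ?thesis using S by (simp add: line_ideal_def)
  qed
  then have far: "\<exists>r>0. \<forall>U\<in>line_ideal M. \<not> op_dist (lp p) c0 S U < r" if "S \<in> operators (lp p) c0 - line_ideal M" for S
    using that by blast
  have "\<exists>r>0. disjnt (line_ideal M) (mball S r)" if "S \<in> operators (lp p) c0 - line_ideal M" for S
    using far[OF that] unfolding disjnt_iff in_mball by blast
  then show ?thesis
    unfolding closedin_metric using line_idealD(1) by blast
qed

lemma closed_op_ideal_line_ideal: "closed_op_ideal (lp p) c0 (line_ideal M)"
proof -
  have sub: "line_ideal M \<subseteq> operators (lp p) c0"
    using line_idealD(1) by blast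
  have avg_zero: "avg n ((\<lambda>x n. 0) \<circ> B) = 0" for n B
    by (simp add: avg_def nrm_c0)
  have zero: "(\<lambda>x n. 0) \<in> line_ideal M"
    unfolding line_ideal_def by (simp only: mem_Collect_eq avg_zero if_cancel) (simp add: zero_operator)
  \<comment> \<open>Scalar multiples reduce to \<open>line_ideal_comp\<close>, with \<open>c\<close>
    times the identity on the left and the identity on the right. Both are set to 0 outside the
    carriers, as \<open>operators\<close> demands.\<close>
  have scale: "(\<lambda>x n. c * S x n) \<in> line_ideal M" if S: "S \<in> line_ideal M" for c S
  proof -
    have A: "(\<lambda>x. if x \<in> vecs c0 then (\<lambda>n. c * x n) else (\<lambda>n. 0)) \<in> operators c0 c0" (is "?A \<in> _")
    proof -
      have "(\<lambda>n. c * x n) \<in> vecs c0" if "x \<in> vecs c0" for x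
        using that by (simp add: tendsto_mult_right_zero)
      moreover have "(\<lambda>n. x n + y n) \<in> vecs c0" if "x \<in> vecs c0" "y \<in> vecs c0" for x y
        using that by (simp add: tendsto_add_zero)
      moreover have "(\<lambda>n. d * x n) \<in> vecs c0" if "x \<in> vecs c0" for d x
        using that by (simp add: tendsto_mult_right_zero)
      moreover have "\<exists>C. \<forall>x\<in>vecs c0. nrm c0 (\<lambda>n. c * x n) \<le> C * nrm c0 x"
        using nrm_c0_scale_le by blast
      ultimately show ?thesis
        unfolding operators_def
        by (auto simp: distrib_left mult.left_commute simp del: vecs_c0)
    qed
    have I: "(\<lambda>x. if x \<in> vecs (lp p) then x else (\<lambda>n. 0)) \<in> operators (lp p) (lp p)" (is "?I \<in> _")
    proof -
      have z: "(\<lambda>n. 0) \<in> vecs (lp p)" using zero_in_unit_ball by blast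
      have "\<forall>x\<in>vecs (lp p). nrm (lp p) x \<le> 1 * nrm (lp p) x" by simp
      then have "\<exists>C. \<forall>x\<in>vecs (lp p). nrm (lp p) x \<le> C * nrm (lp p) x" by blast
      with z show ?thesis
        using lp_add lp_scale unfolding operators_def by (auto simp del: vecs_lp)
    qed
    have "(?A \<circ> S \<circ> ?I) x = (\<lambda>n. c * S x n)" for x
    proof (cases "x \<in> vecs (lp p)")
      case True
      then show ?thesis using operatorsD(1)[OF line_idealD(1)[OF S] True] by (simp del: vecs_lp vecs_c0)
    next
      case False
      have "S (\<lambda>n. 0) = (\<lambda>n. 0)"
        using operatorsD(3)[OF line_idealD(1)[OF S], of "\<lambda>n. 0" 0] zero_in_unit_ball[of p] by simp
      then show ?thesis
        using operatorsD(5)[OF line_idealD(1)[OF S] False] False by (simp del: vecs_lp vecs_c0)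
    qed
    then have "?A \<circ> S \<circ> ?I = (\<lambda>x n. c * S x n)" by blast
    then show ?thesis using line_ideal_comp[OF A S I] by simp
  qed
  show ?thesis
    unfolding closed_op_ideal_def op_ideal_def
    using closedin_line_ideal sub zero scale line_ideal_add line_ideal_comp by blast
qed

end

section \<open>Continuum many ideals\<close>

text \<open>With first component \<open>2 * k\<close> a code records \<open>k \<in> A\<close>, with
  \<open>2 * k + 1\<close> it records \<open>k \<notin> A\<close>; recording both makes the
  differences of two coding sets infinite in either order. The second component provides infinitely
  many copies.\<close>

definition coding_set :: "nat set \<Rightarrow> nat set" where
  "coding_set A = {n. even (fst (prod_decode n)) \<longleftrightarrow> fst (prod_decode n) div 2 \<in> A}"

text \<open>Every truth value \<open>k \<in> A\<close> is coded infinitely often.\<close>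

lemma infinite_coding_set_diff:
  assumes "A \<noteq> A'"
  shows "infinite (coding_set A' - coding_set A)"
proof -
  obtain k where k: "k \<in> A \<longleftrightarrow> k \<notin> A'" using assms by blast
  define m where "m = (if k \<in> A' then 2 * k else 2 * k + 1)"
  have "range (\<lambda>j. prod_encode (m, j)) \<subseteq> coding_set A' - coding_set A"
    using k by (auto simp: m_def coding_set_def)
  moreover have "infinite (range (\<lambda>j. prod_encode (m, j)))"
    by (rule range_inj_infinite) (auto simp: inj_on_def)
  ultimately show ?thesis using finite_subset by blast
qed

theorem theorem1:
  fixes p :: real
  assumes "1 < p"
  shows "\<exists>F. (\<forall>J\<in>F. closed_op_ideal (lp p) c0 J) \<and> F \<approx> (UNIV :: nat set set)"
proof -
  interpret lp_exponent p by unfold_locales (rule assms)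
  have "inj (\<lambda>A. line_ideal (coding_set A))"
  proof (rule injI, rule ccontr)
    fix A A' assume eq: "line_ideal (coding_set A) = line_ideal (coding_set A')" and "A \<noteq> A'"
    \<comment> \<open>The operator of \<open>coding_set A'\<close> lies in its own ideal but not in
      that of \<open>coding_set A\<close>.\<close>
    then show False
      using line_op_mem_line_ideal[of "coding_set A'"] line_op_not_mem_line_ideal[OF infinite_coding_set_diff] by metis
  qed
  then have "range (\<lambda>A. line_ideal (coding_set A)) \<approx> (UNIV :: nat set set)"
    by (rule inj_on_image_eqpoll_self)
  moreover have "\<forall>I\<in>range (\<lambda>A. line_ideal (coding_set A)). closed_op_ideal (lp p) c0 I"
    using closed_op_ideal_line_ideal by auto
  ultimately show ?thesis by (intro exI conjI)
qed

end
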